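(* Let $X$ be a metric space and let $\mu$ be a Borel regular measure over $X$ such that there exists a countable open covering of $X$ whose elements have finite $\mu$ measure. Let $\mathcal{S}$ be a family of closed subsets of $X$, let $\zeta:\mathcal{S}\to[0,+\infty)$, and assume that there exist constants $c,\eta>0$ such that for every $S\in\mathcal{S}$ there exists $\tilde S\in\mathcal{S}$ with $$\hat S\subset\tilde S,\qquad \operatorname{diam}\tilde S\le c\,\operatorname{diam}S\qquad\text{and}\qquad \zeta(\tilde S)\le\eta\,\zeta(S),$$ where $\hat S=\bigcup\{T\in\mathcal{S}: T\cap S\neq\emptyset,\ \operatorname{diam}T\le 2\operatorname{diam}S\}$. Suppose that $A\subset X$ is a Borel set, that $\mathcal{S}_{\mu,\zeta}$ covers $A$ finely, and that $F^\zeta(\mu,\cdot)$ is a Borel function on $A$ with $$\psi_\zeta\big(\{x\in A: F^\zeta(\mu,x)=0\}\big)<+\infty\qquad\text{and}\qquad \mu\big(\{x\in A: F^\zeta(\mu,x)=+\infty\}\big)=0.$$ Then for every Borel set $B\subset A$ we have $$\mu(B)=\int_B F^\zeta(\mu,x)\,d\psi_\zeta(x).$$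
   Context: "Measure over $X$" is meant in Federer's sense: an outer measure $\mu:\mathcal{P}(X)\to[0,+\infty]$ defined on all subsets of $X$. It is Borel regular if open sets are $\mu$-measurable (in Carathéodory's sense) and every $E\subset X$ is contained in a Borel set $E'$ with $\mu(E')=\mu(E)$. Carathéodory construction: given $\mathcal{S}\subset\mathcal{P}(X)$ and a size function $\zeta:\mathcal{S}\to[0,+\infty]$, for $\delta>0$ and $R\subset X$ let $\zeta_\delta(R)$ be the infimum of $\sum_{E\in\mathcal G}\zeta(E)$ over all countable (possibly finite or empty) families $\mathcal G\subset\mathcal{S}$ with $\operatorname{diam}(E)\le\delta$ for all $E\in\mathcal G$ and $R\subset\bigcup_{E\in\mathcal G}E$ (with $\inf\emptyset=+\infty$). Then $\psi_\zeta=\sup_{\delta>0}\zeta_\delta$. Set $$\mathcal{S}_{\mu,\zeta}=\mathcal{S}\setminus\{S\in\mathcal{S}: \zeta(S)=\mu(S)=0\ \text{or}\ \mu(S)=\zeta(S)=+\infty\}.$$ The family $\mathcal{S}_{\mu,\zeta}$ covers $A$ finely if for every $x\in A$ and every $\varepsilon>0$ there exists $S\in\mathcal{S}_{\mu,\zeta}$ with $x\in S$ and $\operatorname{diam}S<\varepsilon$. Define $Q_{\mu,\zeta}:\mathcal{S}_{\mu,\zeta}\to[0,+\infty]$ by $Q_{\mu,\zeta}(S)=+\infty$ if $\zeta(S)=0$, $Q_{\mu,\zeta}(S)=\mu(S)/\zeta(S)$ if $0<\zeta(S)<+\infty$, and $Q_{\mu,\zeta}(S)=0$ if $\zeta(S)=+\infty$.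 The Federer density (upper $\zeta$-density) of $\mu$ at a point $x$ such that sets $S\in\mathcal{S}_{\mu,\zeta}$ containing $x$ exist with arbitrarily small diameter is $$F^\zeta(\mu,x)=\inf_{\varepsilon>0}\ \sup\{Q_{\mu,\zeta}(S): x\in S\in\mathcal{S}_{\mu,\zeta},\ \operatorname{diam}S<\varepsilon\}.$$ *)

theory Defs
  imports "HOL-Analysis.Analysis"
begin

text \<open>
  The ambient metric space is a type of class \<^class>\<open>metric_space\<close>.  A measure in the sense of
  Federer is an outer measure on all subsets, that is, a function \<open>\<mu> :: 'a set \<Rightarrow> ennreal\<close> with
  \<open>outer_measure_space UNIV \<mu>\<close>; its Caratheodory measurable sets are
  \<open>lambda_system UNIV UNIV \<mu>\<close>.
\<close>

definition borel_regular :: "('a::topological_space set \<Rightarrow> ennreal) \<Rightarrow> bool" where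
  "borel_regular \<mu> \<longleftrightarrow>
     outer_measure_space UNIV \<mu> \<and>
     (\<forall>U. open U \<longrightarrow> U \<in> lambda_system UNIV UNIV \<mu>) \<and>
     (\<forall>E. \<exists>E'\<in>sets borel. E \<subseteq> E' \<and> \<mu> E' = \<mu> E)"

text \<open>
  Integrals with respect to an outer measure are taken with respect to its restriction to the
  Caratheodory measurable sets.  By \<open>emeasure_outer_to_measure\<close> below, \<^const>\<open>measure_of\<close> does
  not take its default value here.
\<close>

definition outer_to_measure :: "('a set \<Rightarrow> ennreal) \<Rightarrow> 'a measure" where
  "outer_to_measure \<mu> = measure_of UNIV (lambda_system UNIV UNIV \<mu>) \<mu>"

text \<open>
  \<^const>\<open>diameter\<close> is real-valued and meaningless on unbounded sets, whereas here an unbounded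
  set must have diameter \<open>\<infinity>\<close>.
\<close>

definition ediam :: "'a::metric_space set \<Rightarrow> ennreal" where
  "ediam S = (SUP x\<in>S. SUP y\<in>S. ennreal (dist x y))"

text \<open>
  A size function on the family \<open>\<S>\<close> is a function on all subsets of which only the values on
  members of \<open>\<S>\<close> are used.
\<close>

definition size_delta ::
  "'a::metric_space set set \<Rightarrow> ('a set \<Rightarrow> ennreal) \<Rightarrow> real \<Rightarrow> 'a set \<Rightarrow> ennreal" where
  "size_delta \<S> \<zeta> \<delta> R =
     (INF \<G>\<in>{\<G>. \<G> \<subseteq> \<S> \<and> countable \<G> \<and> (\<forall>E\<in>\<G>. ediam E \<le> ennreal \<delta>) \<and> R \<subseteq> \<Union>\<G>}.
        \<Sum>\<^sub>\<infinity>E\<in>\<G>. \<zeta> E)"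

definition carath_measure ::
  "'a::metric_space set set \<Rightarrow> ('a set \<Rightarrow> ennreal) \<Rightarrow> 'a set \<Rightarrow> ennreal" where
  "carath_measure \<S> \<zeta> R = (SUP \<delta>\<in>{0<..}. size_delta \<S> \<zeta> \<delta> R)"

definition reduced_family ::
  "'a set set \<Rightarrow> ('a set \<Rightarrow> ennreal) \<Rightarrow> ('a set \<Rightarrow> ennreal) \<Rightarrow> 'a set set" where
  "reduced_family \<S> \<mu> \<zeta> =
     \<S> - {S\<in>\<S>. (\<zeta> S = 0 \<and> \<mu> S = 0) \<or> (\<mu> S = \<infinity> \<and> \<zeta> S = \<infinity>)}"

definition covers_finely :: "'a::metric_space set set \<Rightarrow> 'a set \<Rightarrow> bool" where
  "covers_finely \<F> A \<longleftrightarrow> (\<forall>x\<in>A. \<forall>\<epsilon>>0. \<exists>S\<in>\<F>. x \<in> S \<and> ediam S < ennreal \<epsilon>)"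

definition density_quotient ::
  "('a set \<Rightarrow> ennreal) \<Rightarrow> ('a set \<Rightarrow> ennreal) \<Rightarrow> 'a set \<Rightarrow> ennreal" where
  "density_quotient \<mu> \<zeta> S =
     (if \<zeta> S = 0 then \<infinity> else if \<zeta> S = \<infinity> then 0 else \<mu> S / \<zeta> S)"

definition federer_density ::
  "'a::metric_space set set \<Rightarrow> ('a set \<Rightarrow> ennreal) \<Rightarrow> ('a set \<Rightarrow> ennreal) \<Rightarrow> 'a \<Rightarrow> ennreal" where
  "federer_density \<S> \<mu> \<zeta> x =
     (INF \<epsilon>\<in>{0<..}. SUP S\<in>{S\<in>reduced_family \<S> \<mu> \<zeta>. x \<in> S \<and> ediam S < ennreal \<epsilon>}.
        density_quotient \<mu> \<zeta> S)"

definition enlargement :: "'a::metric_space set set \<Rightarrow> 'a set \<Rightarrow> 'a set" where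
  "enlargement \<S> S = \<Union>{T\<in>\<S>. T \<inter> S \<noteq> {} \<and> ediam T \<le> 2 * ediam S}"


lemma measure_space_lambda_system:
  assumes "outer_measure_space UNIV \<mu>"
  shows "measure_space UNIV (lambda_system UNIV UNIV \<mu>) \<mu>"
  using sigma_algebra.caratheodory_lemma[OF sigma_algebra_Pow, of UNIV \<mu>] assms by simp

lemma sets_outer_to_measure:
  assumes "outer_measure_space UNIV \<mu>"
  shows "sets (outer_to_measure \<mu>) = lambda_system UNIV UNIV \<mu>"
proof -
  have "sigma_algebra UNIV (lambda_system UNIV UNIV \<mu>)"
    using measure_space_lambda_system[OF assms] by (simp add: measure_space_def)
  then show ?thesis
    unfolding outer_to_measure_def by (simp add: sigma_algebra.sigma_sets_eq)
qed

lemma emeasure_outer_to_measure: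
  assumes "outer_measure_space UNIV \<mu>" and "E \<in> lambda_system UNIV UNIV \<mu>"
  shows "emeasure (outer_to_measure \<mu>) E = \<mu> E"
  using measure_space_lambda_system[OF assms(1)] assms(2)
  unfolding outer_to_measure_def measure_space_def
  by (intro emeasure_measure_of_sigma) auto

lemma infsum_UN_le_ennreal:
  fixes \<zeta> :: "'b \<Rightarrow> ennreal" and G :: "nat \<Rightarrow> 'b set"
  shows "(\<Sum>\<^sub>\<infinity>E\<in>(\<Union>i. G i). \<zeta> E) \<le> (\<Sum>i. \<Sum>\<^sub>\<infinity>E\<in>G i. \<zeta> E)"
proof -
  have "sum \<zeta> F \<le> (\<Sum>i. \<Sum>\<^sub>\<infinity>E\<in>G i. \<zeta> E)" if F: "finite F" "F \<subseteq> (\<Union>i. G i)" for F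
  proof -
    have "sum \<zeta> F \<le> (\<Sum>E\<in>F. \<Sum>i. \<zeta> E * indicator (G i) E)"
    proof (rule sum_mono)
      fix E assume "E \<in> F"
      then obtain i where "E \<in> G i" using F by auto
      then have "\<zeta> E = (\<Sum>j\<in>{i}. \<zeta> E * indicator (G j) E)" by simp
      also have "\<dots> \<le> (\<Sum>j. \<zeta> E * indicator (G j) E)" by (rule sum_le_suminf) auto
      finally show "\<zeta> E \<le> (\<Sum>j. \<zeta> E * indicator (G j) E)" .
    qed
    also have "\<dots> = (\<Sum>i. \<Sum>E\<in>F. \<zeta> E * indicator (G i) E)"
      by (rule suminf_sum[symmetric]) auto
    also have "\<dots> \<le> (\<Sum>i. \<Sum>\<^sub>\<infinity>E\<in>G i. \<zeta> E)"
    proof (rule suminf_le)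
      fix i
      have "(\<Sum>E\<in>F. \<zeta> E * indicator (G i) E) = sum \<zeta> (F \<inter> G i)"
        using F(1) by (simp add: indicator_def if_distrib sum.inter_restrict cong: if_cong)
      also have "\<dots> \<le> (\<Sum>\<^sub>\<infinity>E\<in>G i. \<zeta> E)"
        using F(1) by (subst nonneg_infsum_complete) (auto intro!: SUP_upper)
      finally show "(\<Sum>E\<in>F. \<zeta> E * indicator (G i) E) \<le> (\<Sum>\<^sub>\<infinity>E\<in>G i. \<zeta> E)" .
    qed auto
    finally show ?thesis .
  qed
  then show ?thesis by (subst nonneg_infsum_complete) (auto intro!: SUP_least)
qed

lemma size_delta_UN_le:
  "size_delta \<S> \<zeta> \<delta> (\<Union>i. R i) \<le> (\<Sum>i. size_delta \<S> \<zeta> \<delta> (R i))"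
proof (rule ennreal_le_epsilon)
  fix e :: real assume fin: "(\<Sum>i. size_delta \<S> \<zeta> \<delta> (R i)) < top" and e: "0 < e"
  define d where "d i = ennreal (e * (1/2) ^ Suc i)" for i
  let ?adm = "\<lambda>i. {\<G>. \<G> \<subseteq> \<S> \<and> countable \<G> \<and> (\<forall>E\<in>\<G>. ediam E \<le> ennreal \<delta>) \<and> R i \<subseteq> \<Union>\<G>}"
  have "\<exists>\<G>. \<G> \<in> ?adm i \<and> (\<Sum>\<^sub>\<infinity>E\<in>\<G>. \<zeta> E) \<le> size_delta \<S> \<zeta> \<delta> (R i) + d i" for i
  proof -
    have "size_delta \<S> \<zeta> \<delta> (R i) < top"
      using fin by (metis ennreal_suminf_lessD)
    moreover have "0 < d i" using e by (simp add: d_def)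
    ultimately have "size_delta \<S> \<zeta> \<delta> (R i) < size_delta \<S> \<zeta> \<delta> (R i) + d i"
      by (simp add: ennreal_add_left_cancel_less)
    then show ?thesis
      unfolding size_delta_def[of _ _ _ "R i"] INF_less_iff Bex_def
      using less_imp_le by fast
  qed
  then have "\<forall>i. \<exists>\<G>. \<G> \<in> ?adm i \<and> (\<Sum>\<^sub>\<infinity>E\<in>\<G>. \<zeta> E) \<le> size_delta \<S> \<zeta> \<delta> (R i) + d i" ..
  from choice[OF this] obtain G where *: "\<forall>i. G i \<in> ?adm i \<and>
      (\<Sum>\<^sub>\<infinity>E\<in>G i. \<zeta> E) \<le> size_delta \<S> \<zeta> \<delta> (R i) + d i" ..
  have G: "G i \<in> ?adm i" for i
    by (rule *[rule_format, THEN conjunct1])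
  have le: "(\<Sum>\<^sub>\<infinity>E\<in>G i. \<zeta> E) \<le> size_delta \<S> \<zeta> \<delta> (R i) + d i" for i
    by (rule *[rule_format, THEN conjunct2])
  have sub: "(\<Union>i. R i) \<subseteq> \<Union>(\<Union>i. G i)"
  proof
    fix x assume "x \<in> (\<Union>i. R i)"
    then obtain i where "x \<in> R i" by blast
    moreover have "R i \<subseteq> \<Union>(G i)" using G[of i] by simp
    ultimately show "x \<in> \<Union>(\<Union>i. G i)" by blast
  qed
  have "G i \<subseteq> \<S>" "countable (G i)" "\<forall>E\<in>G i. ediam E \<le> ennreal \<delta>" for i
    using G[of i] by simp_all
  then have "(\<Union>i. G i) \<subseteq> \<S>" "countable (\<Union>i. G i)"
    "\<forall>E\<in>(\<Union>i. G i). ediam E \<le> ennreal \<delta>"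
    by (blast, simp, blast)
  with sub have "size_delta \<S> \<zeta> \<delta> (\<Union>i. R i) \<le> (\<Sum>\<^sub>\<infinity>E\<in>(\<Union>i. G i). \<zeta> E)"
    unfolding size_delta_def by (intro INF_lower CollectI conjI)
  also have "\<dots> \<le> (\<Sum>i. \<Sum>\<^sub>\<infinity>E\<in>G i. \<zeta> E)" by (rule infsum_UN_le_ennreal)
  also have "\<dots> \<le> (\<Sum>i. size_delta \<S> \<zeta> \<delta> (R i) + d i)" by (intro suminf_le le) auto
  also have "\<dots> = (\<Sum>i. size_delta \<S> \<zeta> \<delta> (R i)) + (\<Sum>i. d i)"
    by (rule suminf_add[symmetric]) auto
  also have "(\<Sum>i. d i) = ennreal e"
  proof -
    have "(\<lambda>i. e * (1/2) ^ Suc i) sums (e * 1)" by (intro sums_mult power_half_series)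
    then show ?thesis unfolding d_def using e by (intro suminf_ennreal_eq) auto
  qed
  finally show "size_delta \<S> \<zeta> \<delta> (\<Union>i. R i) \<le> (\<Sum>i. size_delta \<S> \<zeta> \<delta> (R i)) + ennreal e" .
qed

lemma outer_measure_space_carath_measure: "outer_measure_space UNIV (carath_measure \<S> \<zeta>)"
  unfolding outer_measure_space_def
proof (intro conjI)
  have "size_delta \<S> \<zeta> \<delta> {} \<le> 0" for \<delta>
    unfolding size_delta_def by (rule INF_lower2[of "{}"]) auto
  then show "positive UNIV (carath_measure \<S> \<zeta>)"
    by (simp add: positive_def carath_measure_def)
  show "increasing UNIV (carath_measure \<S> \<zeta>)"
    unfolding increasing_def carath_measure_def size_delta_def
    by (intro ballI impI SUP_mono' INF_superset_mono) auto
  show "countably_subadditive UNIV (carath_measure \<S> \<zeta>)"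
    unfolding countably_subadditive_def
  proof (intro allI impI)
    fix R :: "nat \<Rightarrow> 'a set"
    have "size_delta \<S> \<zeta> \<delta> (\<Union>i. R i) \<le> (\<Sum>i. carath_measure \<S> \<zeta> (R i))" if "0 < \<delta>" for \<delta>
      using that
      by (intro order_trans[OF size_delta_UN_le] suminf_le)
         (auto simp: carath_measure_def intro: SUP_upper)
    then show "carath_measure \<S> \<zeta> (\<Union>i. R i) \<le> (\<Sum>i. carath_measure \<S> \<zeta> (R i))"
      unfolding carath_measure_def[of _ _ "\<Union>i. R i"] by (intro SUP_least) auto
  qed
qed

end

theory Submission
  imports Defs
begin

text \<open>
  Write \<open>\<psi>\<close> for \<^term>\<open>carath_measure \<S> \<zeta>\<close> and \<open>F\<close> for the Federer density; both Borel regularity of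
  \<open>\<mu>\<close> and the Caratheodory criterion for \<open>\<psi>\<close> make Borel sets measurable.  If \<open>F < t\<close> on \<open>E\<close>, then
  \<open>\<mu> S \<le> t \<zeta> S\<close> for all sufficiently small \<open>S\<close> meeting \<open>E\<close> (with smallness made uniform by exhausting
  \<open>E\<close>), so covering \<open>E\<close> gives \<open>\<mu> E \<le> t \<psi> E\<close>.  If \<open>F > t\<close> on \<open>E\<close>, a Vitali covering argument inside an open
  \<open>V \<supseteq> E\<close> gives a disjoint family of sets with \<open>t \<zeta> S \<le> \<mu> S\<close> whose finite parts together with the
  enlargements of the remaining sets cover \<open>E\<close>; hence \<open>t \<psi> E \<le> \<mu> V\<close>, and \<open>t \<psi> E \<le> \<mu> E\<close> by outer
  regularity.  These bounds make \<open>{F = 0}\<close> negligible for \<open>\<mu>\<close> and \<open>{F = \<infinity>}\<close> negligible for \<open>\<psi>\<close>, and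
  on the slices \<open>{l^n \<le> F < l^(n+1)}\<close> they compare \<open>\<mu>\<close> with the integral of \<open>F\<close> up to factors \<open>l\<close> and
  \<open>l^2\<close>; then \<open>l \<rightarrow> 1\<close>.
\<close>

subsection \<open>Outer measures and sums in \<^typ>\<open>ennreal\<close>\<close>

lemma outer_measure_mono:
  "outer_measure_space UNIV \<mu> \<Longrightarrow> E \<subseteq> F \<Longrightarrow> \<mu> E \<le> \<mu> F"
  by (simp add: outer_measure_space_def increasing_def)

lemma outer_measure_empty: "outer_measure_space UNIV \<mu> \<Longrightarrow> \<mu> {} = 0"
  by (simp add: outer_measure_space_def positive_def)

text \<open>The axiom in \<open>outer_measure_space\<close> concerns disjoint sequences only;
  disjointing \<open>R\<close> keeps the union and shrinks each term.\<close>

lemma outer_measure_UN_le: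
  assumes "outer_measure_space UNIV \<mu>"
  shows "\<mu> (\<Union>i. R i) \<le> (\<Sum>i. \<mu> (R i))"
proof -
  have "\<mu> (\<Union>i. R i) = \<mu> (\<Union>i. disjointed R i)"
    by (simp add: UN_disjointed_eq)
  also have "\<dots> \<le> (\<Sum>i. \<mu> (disjointed R i))"
    using assms disjoint_family_disjointed[of R]
    by (auto simp: outer_measure_space_def countably_subadditive_def)
  also have "\<dots> \<le> (\<Sum>i. \<mu> (R i))"
    by (intro suminf_le outer_measure_mono[OF assms] disjointed_subset) auto
  finally show ?thesis .
qed

lemma outer_measure_Un_le:
  assumes "outer_measure_space UNIV \<mu>"
  shows "\<mu> (E \<union> F) \<le> \<mu> E + \<mu> F"
proof -
  have "\<mu> (E \<union> F) = \<mu> (\<Union>i. (if i = 0 then E else if i = Suc 0 then F else {}))"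
    by (intro arg_cong[where f=\<mu>]) (auto split: if_splits)
  also have "\<dots> \<le> (\<Sum>i. \<mu> (if i = 0 then E else if i = Suc 0 then F else {}))"
    by (rule outer_measure_UN_le[OF assms])
  also have "\<dots> = (\<Sum>i<2. \<mu> (if i = 0 then E else if i = Suc 0 then F else {}))"
    by (intro suminf_finite) (auto simp: outer_measure_empty[OF assms])
  also have "\<dots> = \<mu> E + \<mu> F"
    by (simp add: numeral_2_eq_2)
  finally show ?thesis .
qed

lemma suminf_le_infsum_ennreal:
  fixes f :: "nat \<Rightarrow> ennreal"
  shows "(\<Sum>i. f i) \<le> infsum f UNIV"
  by (subst suminf_eq_SUP, subst nonneg_infsum_complete) (auto intro!: SUP_mono)

lemma outer_measure_le_infsum:
  assumes \<mu>: "outer_measure_space UNIV \<mu>" and "countable \<G>" "E \<subseteq> \<Union>\<G>"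
  shows "\<mu> E \<le> (\<Sum>\<^sub>\<infinity>S\<in>\<G>. \<mu> S)"
proof -
  let ?n = "to_nat_on \<G>"
  \<comment> \<open>Off the range of \<open>?n\<close>, \<open>from_nat_into\<close> would repeat a
    member of \<open>\<G>\<close>. The value \<open>{}\<close> contributes nothing there, so each
    member is counted exactly once.\<close>
  define f where "f n = (if n \<in> ?n ` \<G> then from_nat_into \<G> n else {})" for n
  have f: "f (?n S) = S" if "S \<in> \<G>" for S
    using that assms(2) by (simp add: f_def)
  have "E \<subseteq> (\<Union>n. f n)"
    using assms(3) f by blast
  then have "\<mu> E \<le> (\<Sum>n. \<mu> (f n))"
    using outer_measure_mono[OF \<mu>] outer_measure_UN_le[OF \<mu>] order_trans by blast
  also have "\<dots> \<le> infsum (\<lambda>n. \<mu> (f n)) UNIV"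
    by (rule suminf_le_infsum_ennreal)
  also have "\<dots> = infsum (\<lambda>n. \<mu> (f n)) (?n ` \<G>)"
    by (rule infsum_cong_neutral) (auto simp: f_def outer_measure_empty[OF \<mu>])
  also have "\<dots> = infsum \<mu> \<G>"
    using assms(2) by (subst infsum_reindex) (auto simp: f cong: infsum_cong)
  finally show ?thesis .
qed

section \<open>Unconditional sums in \<open>ennreal\<close> over families of sets\<close>

lemma infsum_cmult_ennreal:
  fixes f :: "'b \<Rightarrow> ennreal"
  shows "(\<Sum>\<^sub>\<infinity>x\<in>G. c * f x) = c * infsum f G"
  by (simp add: nonneg_infsum_complete SUP_mult_left_ennreal sum_distrib_left)

lemma infsum_mono_ennreal:
  fixes f g :: "'b \<Rightarrow> ennreal"
  assumes "G \<subseteq> H" "\<And>x. x \<in> G \<Longrightarrow> f x \<le> g x"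
  shows "infsum f G \<le> infsum g H"
  by (rule infsum_mono_neutral) (use assms in \<open>auto intro: nonneg_summable_on_complete\<close>)

text \<open>One preimage per image point already yields the left side. This is meant for the choice
  of enlargements, which may send different sets to the same one.\<close>

lemma infsum_image_le_ennreal:
  fixes f :: "'b \<Rightarrow> ennreal"
  shows "infsum f (h ` G) \<le> infsum (\<lambda>x. f (h x)) G"
proof -
  obtain G' where "G' \<subseteq> G" "inj_on h G'" "h ` G = h ` G'"
    using subset_image_inj[of "h ` G" h G] by auto
  then show ?thesis
    by (simp add: infsum_reindex infsum_mono_ennreal)
qed

lemma infsum_Un_le_ennreal:
  fixes f :: "'b \<Rightarrow> ennreal"
  shows "infsum f (G \<union> H) \<le> infsum f G + infsum f H"
proof -
  have "infsum f (G \<union> (H - G)) = infsum f G + infsum f (H - G)"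
    by (rule infsum_Un_disjoint) (auto intro: nonneg_summable_on_complete)
  then show ?thesis
    by (simp add: add_left_mono infsum_mono_ennreal)
qed

lemma suminf_tail_le:
  fixes r :: "nat \<Rightarrow> ennreal"
  assumes "(\<Sum>i. r i) < \<infinity>" "0 < e"
  shows "\<exists>n. (\<Sum>i. r (i + n)) \<le> ennreal e"
proof -
  have "(\<Sum>i. r i) \<noteq> \<infinity>" using assms by auto
  then have fin: "r i \<noteq> \<infinity>" for i
    using ennreal_suminf_lessD[of r \<infinity> i] assms by auto
  define q where "q i = enn2real (r i)" for i
  have r: "r i = ennreal (q i)" for i
    using fin[of i] by (simp add: q_def less_top)
  have q: "0 \<le> q i" for i by (simp add: q_def)
  have sm: "summable q"
    using assms(1) by (intro summable_suminf_not_top) (auto simp: q r[symmetric])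
  obtain N where N: "\<And>n. n \<ge> N \<Longrightarrow> norm (\<Sum>i. q (i + n)) < e"
    using suminf_exist_split[OF assms(2) sm] by blast
  have "(\<Sum>i. r (i + N)) = ennreal (\<Sum>i. q (i + N))"
    unfolding r by (intro suminf_ennreal2 q summable_ignore_initial_segment sm)
  also have "\<dots> \<le> ennreal e"
    using N[of N] by (intro ennreal_leI) auto
  finally show ?thesis ..
qed

subsection \<open>The Caratheodory criterion\<close>

text \<open>Induction peels off the last set, which keeps a positive distance from all earlier ones.
  That distance may depend on \<open>n\<close>, because only finite unions are split before
  monotonicity bounds them by the whole union.\<close>

lemma suminf_outer_measure_le:
  fixes R :: "nat \<Rightarrow> 'a::metric_space set"
  assumes \<mu>: "outer_measure_space UNIV \<mu>"
    and metric: "\<And>E F d. 0 < d \<Longrightarrow> (\<And>x y. x \<in> E \<Longrightarrow> y \<in> F \<Longrightarrow> d \<le> dist x y) \<Longrightarrow>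
                  \<mu> E + \<mu> F \<le> \<mu> (E \<union> F)"
    and sep: "\<And>n. \<exists>d>0. \<forall>i<n. \<forall>x\<in>R i. \<forall>y\<in>R n. d \<le> dist x y"
  shows "(\<Sum>i. \<mu> (R i)) \<le> \<mu> (\<Union>i. R i)"
proof -
  have "(\<Sum>i<n. \<mu> (R i)) \<le> \<mu> (\<Union>i<n. R i)" for n
  proof (induction n)
    case (Suc n)
    obtain d where d: "d > 0" "\<forall>i<n. \<forall>x\<in>R i. \<forall>y\<in>R n. d \<le> dist x y"
      using sep by blast
    have "(\<Sum>i<Suc n. \<mu> (R i)) \<le> \<mu> (\<Union>i<n. R i) + \<mu> (R n)"
      using Suc by (simp add: add_right_mono)
    also have "\<dots> \<le> \<mu> ((\<Union>i<n. R i) \<union> R n)"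
      by (rule metric[OF d(1)]) (use d(2) in auto)
    also have "(\<Union>i<n. R i) \<union> R n = (\<Union>i<Suc n. R i)"
      by (auto simp: less_Suc_eq)
    finally show ?case .
  qed simp
  also have "\<And>n. \<mu> (\<Union>i<n. R i) \<le> \<mu> (\<Union>i. R i)"
    by (intro outer_measure_mono[OF \<mu>]) auto
  finally show ?thesis
    by (intro suminf_le_const) auto
qed

text \<open>The part \<open>D n\<close> of \<open>T\<close> lies at distance at least
  \<open>1 / Suc n\<close> from \<open>C\<close>, so \<open>metric\<close> separates it from
  \<open>C \<inter> T\<close>. What remains of \<open>T - C\<close> is covered by the rings
  \<open>R i\<close> with \<open>i \<ge> n\<close>; the measures of all rings have a finite sum if
  \<open>\<mu> T\<close> is finite, so this remainder becomes negligible.\<close>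

lemma caratheodory_criterion:
  fixes \<mu> :: "'a::metric_space set \<Rightarrow> ennreal"
  assumes \<mu>: "outer_measure_space UNIV \<mu>"
    and metric: "\<And>E F d. 0 < d \<Longrightarrow> (\<And>x y. x \<in> E \<Longrightarrow> y \<in> F \<Longrightarrow> d \<le> dist x y) \<Longrightarrow>
                  \<mu> E + \<mu> F \<le> \<mu> (E \<union> F)"
    and C: "closed C"
  shows "C \<in> lambda_system UNIV UNIV \<mu>"
proof (cases "C = {}")
  case True
  then show ?thesis
    using outer_measure_empty[OF \<mu>] by (simp add: lambda_system_def)
next
  case False
  have "\<mu> (C \<inter> T) + \<mu> (T - C) \<le> \<mu> T" for T
  proof (cases "\<mu> T = \<infinity>")
    case True
    then show ?thesis by simp
  next
    case fin: False
    define D where "D n = {x\<in>T. 1 / real (Suc n) \<le> infdist x C}" for n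
    define R where "R n = D (Suc n) - D n" for n
    have pos: "0 < infdist x C" if "x \<notin> C" for x
      using that in_closed_iff_infdist_zero[OF C False] infdist_nonneg[of x C] by (simp add: less_le)
    have Dmono: "D i \<subseteq> D j" if "i \<le> j" for i j
    proof
      fix x assume x: "x \<in> D i"
      have "1 / real (Suc j) \<le> 1 / real (Suc i)"
        using that by (simp add: frac_le)
      with x show "x \<in> D j" by (simp add: D_def)
    qed
    have lt: "infdist x C < 1 / real (Suc i)" if "x \<in> R i" for x i
      using that by (auto simp: R_def D_def)
    \<comment> \<open>Adjacent rings \<open>R i\<close> may touch, so the even and the odd ones are summed separately.\<close>
    have sep: "\<exists>d>0. \<forall>i. Suc i < n \<longrightarrow> (\<forall>x\<in>R n. \<forall>y\<in>R i. d \<le> dist x y)" for n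
    proof (cases n)
      case (Suc m)
      \<comment> \<open>For \<open>Suc i < n\<close> the ring \<open>R i\<close> lies in
        \<open>D m\<close>, while points of \<open>R n\<close> are closer to \<open>C\<close> than
        \<open>1 / Suc n\<close>; \<open>d\<close> is the gap between these two bounds.\<close>
      define d where "d = 1 / real (Suc m) - 1 / real (Suc n)"
      have "d > 0" by (simp add: d_def Suc frac_less2)
      moreover have "d \<le> dist x y" if i: "Suc i < n" and x: "x \<in> R n" and y: "y \<in> R i" for i x y
      proof -
        have "y \<in> D m"
          using y Dmono[of "Suc i" m] i Suc by (auto simp: R_def)
        then have "1 / real (Suc m) \<le> infdist y C" by (simp add: D_def)
        moreover have "infdist y C \<le> infdist x C + dist x y"
          using infdist_triangle[of y C x] by (simp add: dist_commute)
        ultimately show ?thesis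
          using lt[OF x] by (simp add: d_def)
      qed
      ultimately show ?thesis by blast
    qed (auto intro: zero_less_one)
    have RT: "R i \<subseteq> T" for i by (auto simp: R_def D_def)
    have "(\<Sum>i. \<mu> (R (2 * i + b))) \<le> \<mu> T" for b
    proof -
      have "(\<Sum>i. \<mu> (R (2 * i + b))) \<le> \<mu> (\<Union>i. R (2 * i + b))"
      proof (rule suminf_outer_measure_le[OF \<mu> metric])
        fix n
        obtain d where d: "d > 0" "\<And>i x y. Suc i < 2 * n + b \<Longrightarrow> x \<in> R (2 * n + b) \<Longrightarrow> y \<in> R i \<Longrightarrow> d \<le> dist x y"
          using sep[of "2 * n + b"] by blast
        have "d \<le> dist x y" if "i < n" "x \<in> R (2 * i + b)" "y \<in> R (2 * n + b)" for i x y
          using d(2)[of "2 * i + b" y x] that by (simp add: dist_commute)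
        with d(1) show "\<exists>d>0. \<forall>i<n. \<forall>x\<in>R (2 * i + b). \<forall>y\<in>R (2 * n + b). d \<le> dist x y"
          by blast
      qed
      also have "\<dots> \<le> \<mu> T"
        using RT by (intro outer_measure_mono[OF \<mu>]) auto
      finally show ?thesis .
    qed
    note half = this[of 0] this[of 1]
    have "(\<Sum>i. \<mu> (R i)) \<le> \<mu> T + \<mu> T"
    proof (rule suminf_le_const)
      fix n
      have "(\<Sum>i<n. \<mu> (R i)) \<le> (\<Sum>i<2 * n. \<mu> (R i))"
        by (intro sum_mono2) auto
      also have "\<dots> = (\<Sum>i<n. \<mu> (R (2 * i + 0))) + (\<Sum>i<n. \<mu> (R (2 * i + 1)))"
        by (induction n) (simp_all add: algebra_simps)
      also have "\<dots> \<le> (\<Sum>i. \<mu> (R (2 * i + 0))) + (\<Sum>i. \<mu> (R (2 * i + 1)))"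
        by (intro add_mono sum_le_suminf) auto
      also have "\<dots> \<le> \<mu> T + \<mu> T"
        by (intro add_mono half)
      finally show "(\<Sum>i<n. \<mu> (R i)) \<le> \<mu> T + \<mu> T" .
    qed auto
    also have "\<mu> T + \<mu> T < \<infinity>"
      using fin by (simp add: less_top)
    finally have summ: "(\<Sum>i. \<mu> (R i)) < \<infinity>" .
    show ?thesis
    proof (rule ennreal_le_epsilon)
      fix e :: real assume "0 < e"
      obtain n where n: "(\<Sum>i. \<mu> (R (i + n))) \<le> ennreal e"
        using suminf_tail_le[OF summ \<open>0 < e\<close>] by blast
      have "T - C \<subseteq> D n \<union> (\<Union>i. R (i + n))"
      proof
        fix x assume x: "x \<in> T - C"
        then obtain k where "1 / real (Suc k) < infdist x C"
          using pos[of x] nat_approx_posE by auto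
        then have "x \<in> D k" using x by (simp add: D_def)
        then have ex: "\<exists>k. x \<in> D (k + n)"
          using Dmono[of k "k + n"] by auto
        \<comment> \<open>If \<open>x\<close> is not yet in \<open>D n\<close>, the first later
          index at which it enters identifies its ring.\<close>
        define k0 where "k0 = (LEAST k. x \<in> D (k + n))"
        have k0: "x \<in> D (k0 + n)" unfolding k0_def by (rule LeastI_ex[OF ex])
        show "x \<in> D n \<union> (\<Union>i. R (i + n))"
        proof (cases k0)
          case 0
          then show ?thesis using k0 by simp
        next
          case (Suc l)
          then have "x \<notin> D (l + n)"
            using not_less_Least[of l "\<lambda>k. x \<in> D (k + n)"] by (simp add: k0_def)
          then have "x \<in> R (l + n)" using k0 Suc by (simp add: R_def)
          then show ?thesis by blast
        qed
      qed
      then have "\<mu> (T - C) \<le> \<mu> (D n \<union> (\<Union>i. R (i + n)))"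
        by (rule outer_measure_mono[OF \<mu>])
      also have "\<dots> \<le> \<mu> (D n) + \<mu> (\<Union>i. R (i + n))"
        by (rule outer_measure_Un_le[OF \<mu>])
      also have "\<mu> (\<Union>i. R (i + n)) \<le> ennreal e"
        using outer_measure_UN_le[OF \<mu>, of "\<lambda>i. R (i + n)"] n by (rule order_trans)
      finally have "\<mu> (C \<inter> T) + \<mu> (T - C) \<le> (\<mu> (C \<inter> T) + \<mu> (D n)) + ennreal e"
        by (simp add: add_left_mono add.assoc)
      also have "\<mu> (C \<inter> T) + \<mu> (D n) \<le> \<mu> ((C \<inter> T) \<union> D n)"
      proof (rule metric[of "1 / real (Suc n)"])
        fix x y assume "x \<in> C \<inter> T" "y \<in> D n"
        then show "1 / real (Suc n) \<le> dist x y"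
          using infdist_le[of x C y] by (simp add: D_def dist_commute)
      qed simp
      also have "\<dots> \<le> \<mu> T"
        by (intro outer_measure_mono[OF \<mu>]) (auto simp: D_def)
      finally show "\<mu> (C \<inter> T) + \<mu> (T - C) \<le> \<mu> T + ennreal e"
        by (simp add: add_right_mono)
    qed
  qed
  moreover have "\<mu> T \<le> \<mu> (C \<inter> T) + \<mu> (T - C)" for T
  proof -
    have "C \<inter> T \<union> (T - C) = T" by auto
    then show ?thesis
      using outer_measure_Un_le[OF \<mu>, of "C \<inter> T" "T - C"] by simp
  qed
  moreover have "(UNIV - C) \<inter> T = T - C" for T by auto
  ultimately show ?thesis
    by (simp add: lambda_system_def antisym)
qed

lemma borel_subset_lambda_system:
  fixes \<mu> :: "'a::metric_space set \<Rightarrow> ennreal"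
  assumes "outer_measure_space UNIV \<mu>" and "\<And>U. open U \<Longrightarrow> U \<in> lambda_system UNIV UNIV \<mu>"
  shows "sets borel \<subseteq> lambda_system UNIV UNIV \<mu>"
proof -
  interpret sigma_algebra UNIV "lambda_system UNIV UNIV \<mu>"
    using measure_space_lambda_system[OF assms(1)] by (simp add: measure_space_def)
  show ?thesis
    unfolding borel_def using assms(2) sigma_sets_subset[of "Collect open"] by auto
qed

lemma lambda_system_UNIV_Compl:
  "E \<in> lambda_system UNIV UNIV \<mu> \<Longrightarrow> - E \<in> lambda_system UNIV UNIV (\<mu> :: _ \<Rightarrow> ennreal)"
  by (simp add: lambda_system_def Compl_eq_Diff_UNIV[symmetric] add.commute)

section \<open>Additivity of the Caratheodory construction on sets at positive distance\<close>

lemma size_delta_mono: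
  assumes "E \<subseteq> F" "\<delta> \<le> \<delta>'"
  shows "size_delta \<S> \<zeta> \<delta>' E \<le> size_delta \<S> \<zeta> \<delta> F"
proof -
  have "ennreal \<delta> \<le> ennreal \<delta>'" using assms(2) by (rule ennreal_leI)
  then show ?thesis
    unfolding size_delta_def
    by (intro INF_superset_mono) (use assms(1) in \<open>auto intro: order_trans\<close>)
qed

lemma size_delta_le_carath:
  "0 < \<delta> \<Longrightarrow> size_delta \<S> \<zeta> \<delta> E \<le> carath_measure \<S> \<zeta> E"
  unfolding carath_measure_def by (rule SUP_upper) auto

lemma dist_le_ediam: "x \<in> S \<Longrightarrow> y \<in> S \<Longrightarrow> ennreal (dist x y) \<le> ediam S"
  unfolding ediam_def by (rule SUP_upper2, assumption, rule SUP_upper)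

text \<open>A set of diameter at most \<open>\<delta> < d\<close> cannot meet both \<open>E\<close>
  and \<open>F\<close>, so each cover of the union contains disjoint subfamilies covering
  \<open>E\<close> and \<open>F\<close>.\<close>

lemma size_delta_separated:
  assumes d: "0 < d" "\<And>x y. x \<in> E \<Longrightarrow> y \<in> F \<Longrightarrow> d \<le> dist x y" and "\<delta> < d"
  shows "size_delta \<S> \<zeta> \<delta> E + size_delta \<S> \<zeta> \<delta> F \<le> size_delta \<S> \<zeta> \<delta> (E \<union> F)"
  unfolding size_delta_def[of _ _ _ "E \<union> F"]
proof (rule INF_greatest, clarify)
  fix \<G> assume G: "\<G> \<subseteq> \<S>" "countable \<G>" "\<forall>S\<in>\<G>. ediam S \<le> ennreal \<delta>" "E \<union> F \<subseteq> \<Union>\<G>"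
  define H where "H R = {S\<in>\<G>. S \<inter> R \<noteq> {}}" for R :: "'a set"
  have le: "size_delta \<S> \<zeta> \<delta> R \<le> infsum \<zeta> (H R)" if "R \<subseteq> E \<union> F" for R
    unfolding size_delta_def
  proof (rule INF_lower, intro CollectI conjI)
    show "R \<subseteq> \<Union>(H R)" using G(4) that unfolding H_def by blast
  qed (use G in \<open>auto simp: H_def\<close>)
  have "H E \<inter> H F = {}"
  proof (rule ccontr)
    assume "H E \<inter> H F \<noteq> {}"
    then obtain S x y where S: "S \<in> \<G>" "x \<in> S" "x \<in> E" "y \<in> S" "y \<in> F"
      by (auto simp: H_def)
    then have "ennreal d \<le> ennreal (dist x y)" by (intro ennreal_leI d)
    also have "\<dots> \<le> ennreal \<delta>"
      using S G dist_le_ediam order_trans by blast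
    finally show False
      \<comment> \<open>For negative \<open>\<delta>\<close> the value
        \<open>ennreal \<delta>\<close> is 0, still below \<open>ennreal d\<close>.\<close>
      using \<open>\<delta> < d\<close> d(1) by (cases "0 \<le> \<delta>") (auto simp: ennreal_neg)
  qed
  then have "infsum \<zeta> (H E \<union> H F) = infsum \<zeta> (H E) + infsum \<zeta> (H F)"
    by (intro infsum_Un_disjoint) (auto intro: nonneg_summable_on_complete)
  moreover have "infsum \<zeta> (H E \<union> H F) \<le> infsum \<zeta> \<G>"
    by (rule infsum_mono_ennreal) (auto simp: H_def)
  ultimately show "size_delta \<S> \<zeta> \<delta> E + size_delta \<S> \<zeta> \<delta> F \<le> infsum \<zeta> \<G>"
    using add_mono[OF le[of E] le[of F]] by simp
qed

lemma carath_measure_separated: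
  assumes d: "0 < d" "\<And>x y. x \<in> E \<Longrightarrow> y \<in> F \<Longrightarrow> d \<le> dist x y"
  shows "carath_measure \<S> \<zeta> E + carath_measure \<S> \<zeta> F \<le> carath_measure \<S> \<zeta> (E \<union> F)"
proof -
  have "size_delta \<S> \<zeta> a E + size_delta \<S> \<zeta> b F \<le> carath_measure \<S> \<zeta> (E \<union> F)"
    if "0 < a" "0 < b" for a b
  proof -
    define \<delta> where "\<delta> = min (min a b) (d / 2)"
    have \<delta>: "0 < \<delta>" "\<delta> \<le> a" "\<delta> \<le> b" "\<delta> < d"
      using that d(1) by (auto simp: \<delta>_def)
    have "size_delta \<S> \<zeta> a E + size_delta \<S> \<zeta> b F \<le> size_delta \<S> \<zeta> \<delta> E + size_delta \<S> \<zeta> \<delta> F"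
      by (intro add_mono size_delta_mono \<delta> order_refl)
    also have "\<dots> \<le> size_delta \<S> \<zeta> \<delta> (E \<union> F)"
      by (rule size_delta_separated[OF d \<delta>(4)])
    also have "\<dots> \<le> carath_measure \<S> \<zeta> (E \<union> F)"
      by (rule size_delta_le_carath[OF \<delta>(1)])
    finally show ?thesis .
  qed
  \<comment> \<open>The suprema over \<open>b\<close> and then over \<open>a\<close> are pulled out
    of the sum one at a time; the witness 1 shows that their index set is nonempty.\<close>
  then have "size_delta \<S> \<zeta> a E + carath_measure \<S> \<zeta> F \<le> carath_measure \<S> \<zeta> (E \<union> F)" if "0 < a" for a
    unfolding carath_measure_def[of _ _ F] using that
    by (subst ennreal_SUP_add_right) (auto intro!: SUP_least exI[of _ 1])
  then show ?thesis
    unfolding carath_measure_def[of _ _ E]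
    by (subst ennreal_SUP_add_left[symmetric]) (auto intro!: SUP_least exI[of _ 1])
qed

lemma borel_carath_measurable:
  "sets borel \<subseteq> lambda_system UNIV UNIV (carath_measure \<S> \<zeta>)"
proof (rule borel_subset_lambda_system[OF outer_measure_space_carath_measure])
  fix U :: "'a set" assume "open U"
  then have "- U \<in> lambda_system UNIV UNIV (carath_measure \<S> \<zeta>)"
    by (intro caratheodory_criterion outer_measure_space_carath_measure carath_measure_separated)
       (auto simp: closed_Compl)
  from lambda_system_UNIV_Compl[OF this] show "U \<in> lambda_system UNIV UNIV (carath_measure \<S> \<zeta>)"
    by simp
qed

subsection \<open>Regularity of Borel measures on metric spaces\<close>

text \<open>The metric neighbourhoods of radius \<open>1 / Suc n\<close> shrink to \<open>C\<close>.
  The empty set is treated apart because \<open>infdist x {}\<close> is 0 by convention, which would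
  make every neighbourhood the whole space.\<close>

lemma closed_decseq_nbhd:
  fixes C :: "'a::metric_space set"
  assumes "closed C"
  obtains V where "decseq V" "\<And>n::nat. open (V n)" "(\<Inter>n. V n) = C"
proof (cases "C = {}")
  case True
  then show ?thesis by (intro that[of "\<lambda>_. {}"]) (auto simp: decseq_def)
next
  case False
  let ?V = "\<lambda>n. {x. infdist x C < 1 / real (Suc n)}"
  show ?thesis
  proof (rule that[of ?V])
    show "decseq ?V"
    proof (rule decseq_SucI, clarify)
      fix n x assume "infdist x C < 1 / real (Suc (Suc n))"
      also have "\<dots> \<le> 1 / real (Suc n)" by (simp add: frac_le)
      finally show "infdist x C < 1 / real (Suc n)" .
    qed
    show "open (?V n)" for n
      by (intro open_Collect_less continuous_intros)
    have "x \<in> C" if "\<And>n. infdist x C < 1 / real (Suc n)" for x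
    proof (rule ccontr)
      assume "x \<notin> C"
      then have "0 < infdist x C"
        using in_closed_iff_infdist_zero[OF assms False] infdist_nonneg[of x C] by (simp add: less_le)
      then obtain n where "1 / real (Suc n) < infdist x C" by (rule nat_approx_posE)
      with that[of n] show False by simp
    qed
    then show "(\<Inter>n. ?V n) = C" by auto
  qed
qed

lemma ennreal_tendsto_le_epsilon:
  fixes f :: "nat \<Rightarrow> ennreal"
  assumes "f \<longlonglongrightarrow> L" "L < \<infinity>" "0 < e"
  shows "\<exists>n. f n \<le> L + ennreal e"
proof -
  have "L < L + ennreal e"
    using assms(2,3) by (cases L) (auto simp: ennreal_plus[symmetric] ennreal_less_iff simp del: ennreal_plus)
  then have "\<forall>\<^sub>F n in sequentially. f n < L + ennreal e"
    using assms(1) by (simp add: order_tendstoD)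
  then show ?thesis
    using eventually_happens less_imp_le by (metis sequentially_bot)
qed

text \<open>Induction over the sigma algebra generated by the closed sets. Approximating from inside
  and outside at once makes the complement step a mere exchange of roles; finiteness of
  \<open>N\<close> provides continuity from above.\<close>

lemma borel_closed_open_approx:
  fixes N :: "'a::metric_space measure"
  assumes borel: "sets borel \<subseteq> sets N" and fin: "emeasure N UNIV < \<infinity>"
    and E: "E \<in> sets borel" and "0 < e"
  shows "\<exists>C V. closed C \<and> open V \<and> C \<subseteq> E \<and> E \<subseteq> V \<and> emeasure N (V - C) \<le> ennreal e"
proof -
  have op: "V \<in> sets N" if "open V" for V using that borel by auto
  have cl: "C \<in> sets N" if "closed C" for C using that borel by auto
  have finN: "emeasure N G \<noteq> \<infinity>" for G
  proof -
    have "emeasure N G \<le> emeasure N UNIV"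
      using op[of UNIV] by (intro emeasure_mono) auto
    with fin show ?thesis by auto
  qed
  have "E \<in> sigma_sets UNIV {C. closed C}"
    using E by (simp add: borel_eq_closed sets_measure_of_conv)
  then show ?thesis using \<open>0 < e\<close>
  proof (induction arbitrary: e rule: sigma_sets.induct)
    case (Basic C)
    then have C: "closed C" by simp
    obtain V where V: "decseq V" "\<And>n::nat. open (V n)" "(\<Inter>n. V n) = C"
      using closed_decseq_nbhd[OF C] by blast
    have sub: "C \<subseteq> V n" for n using V(3) by blast
    have "(\<lambda>n. emeasure N (V n - C)) \<longlonglongrightarrow> emeasure N (\<Inter>n. V n - C)"
      using V op cl[OF C] finN by (intro Lim_emeasure_decseq) (auto simp: decseq_def)
    moreover have "(\<Inter>n. V n - C) = {}" using V(3) by auto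
    ultimately have "(\<lambda>n. emeasure N (V n - C)) \<longlonglongrightarrow> 0"
      by (simp only: emeasure_empty)
    then obtain n where "emeasure N (V n - C) \<le> 0 + ennreal e"
      using ennreal_tendsto_le_epsilon[of _ 0 e] Basic(2) by auto
    then show ?case
      using C V(2) sub by (intro exI[of _ C] exI[of _ "V n"]) auto
  next
    case Empty
    show ?case by (intro exI[of _ "{}"]) auto
  next
    case (Compl G)
    obtain C V where "closed C" "open V" "C \<subseteq> G" "G \<subseteq> V" "emeasure N (V - C) \<le> ennreal e"
      using Compl.IH[OF Compl.prems] by blast
    moreover have "- C - - V = V - C" by auto
    ultimately show ?case
      by (intro exI[of _ "- V"] exI[of _ "- C"]) auto
  next
    case (Union G)
    \<comment> \<open>These errors add up to \<open>e / 2\<close>. The other half pays for replacing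
      the union of all \<open>C i\<close>, which need not be closed, by a finite subunion.\<close>
    define d where "d i = e / 2 * (1/2) ^ Suc i" for i :: nat
    have dpos: "0 < d i" for i using Union.prems by (simp add: d_def)
    have "\<forall>i. \<exists>C V. closed C \<and> open V \<and> C \<subseteq> G i \<and> G i \<subseteq> V \<and> emeasure N (V - C) \<le> ennreal (d i)"
      using Union.IH[OF dpos] ..
    from choice[OF this] obtain C where "\<forall>i. \<exists>V. closed (C i) \<and> open V \<and> C i \<subseteq> G i \<and> G i \<subseteq> V \<and>
        emeasure N (V - C i) \<le> ennreal (d i)" ..
    from choice[OF this] obtain V where "\<forall>i. closed (C i) \<and> open (V i) \<and> C i \<subseteq> G i \<and> G i \<subseteq> V i \<and>
        emeasure N (V i - C i) \<le> ennreal (d i)" ..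
    then have CV: "\<And>i. closed (C i)" "\<And>i. open (V i)" "\<And>i. C i \<subseteq> G i" "\<And>i. G i \<subseteq> V i"
        "\<And>i. emeasure N (V i - C i) \<le> ennreal (d i)"
      by simp_all
    let ?V = "\<Union>i. V i" and ?D = "\<lambda>n. \<Union>i<n. C i"
    have D: "closed (?D n)" for n using CV(1) by auto
    have Cs: "C i \<in> sets N" for i by (rule cl[OF CV(1)])
    have V: "open ?V" using CV(2) by auto
    have "(\<lambda>n. emeasure N (?V - ?D n)) \<longlonglongrightarrow> emeasure N (\<Inter>n. ?V - ?D n)"
      using op[OF V] cl[OF D] finN by (intro Lim_emeasure_decseq) (auto simp: decseq_def)
    moreover have "emeasure N (\<Inter>n. ?V - ?D n) < \<infinity>" using finN by (simp add: less_top)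
    ultimately obtain n where n: "emeasure N (?V - ?D n) \<le> emeasure N (\<Inter>n. ?V - ?D n) + ennreal (e / 2)"
      using ennreal_tendsto_le_epsilon Union.prems by (metis half_gt_zero)
    have "emeasure N (\<Inter>n. ?V - ?D n) \<le> emeasure N (\<Union>i. V i - C i)"
    proof (rule emeasure_mono)
      show "(\<Union>i. V i - C i) \<in> sets N" using op[OF CV(2)] Cs by auto
    qed blast
    also have "\<dots> \<le> (\<Sum>i. emeasure N (V i - C i))"
      using op[OF CV(2)] Cs by (intro emeasure_subadditive_countably) auto
    also have "\<dots> \<le> (\<Sum>i. ennreal (d i))"
      by (intro suminf_le CV) auto
    also have "\<dots> = ennreal (e / 2)"
    proof (intro suminf_ennreal_eq)
      have "d sums (e / 2 * 1)"
        unfolding d_def by (intro sums_mult power_half_series)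
      then show "d sums (e / 2)" by simp
    qed (use dpos in \<open>simp add: less_imp_le\<close>)
    finally have "emeasure N (?V - ?D n) \<le> ennreal (e / 2) + ennreal (e / 2)"
      using n by (meson add_right_mono order_trans)
    also have "\<dots> = ennreal e"
      using Union.prems by (simp add: ennreal_plus[symmetric] del: ennreal_plus)
    finally show ?case
      using D[of n] V CV(3,4) by (intro exI[of _ "?D n"] exI[of _ ?V]) (simp, blast)
  qed
qed

text \<open>Each \<open>U i\<close> carries a finite restriction of \<open>N\<close>, to which the
  previous approximation applies with error \<open>d i\<close>. The sets
  \<open>U i \<inter> V i\<close> then form an open cover of \<open>E\<close> whose total excess is
  at most \<open>e\<close>.\<close>

lemma borel_outer_regular:
  fixes N :: "'a::metric_space measure"
  assumes borel: "sets borel \<subseteq> sets N"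
    and cover: "countable \<U>" "\<And>U. U \<in> \<U> \<Longrightarrow> open U \<and> emeasure N U < \<infinity>" "\<Union>\<U> = UNIV"
    and E: "E \<in> sets borel" and "0 < e"
  shows "\<exists>V. open V \<and> E \<subseteq> V \<and> emeasure N V \<le> emeasure N E + ennreal e"
proof -
  have op: "V \<in> sets N" if "open V" for V :: "'a set" using that borel by auto
  have EN: "E \<in> sets N" using E borel by auto
  have ne: "\<U> \<noteq> {}" using cover(3) by auto
  define U where "U = from_nat_into \<U>"
  have U: "open (U i)" "emeasure N (U i) < \<infinity>" for i
    using cover(2)[OF from_nat_into[OF ne]] by (auto simp: U_def)
  have UU: "(\<Union>i. U i) = UNIV"
    using cover(1,3) ne by (simp add: U_def range_from_nat_into)
  define d where "d i = e * (1/2) ^ Suc i" for i :: nat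
  have dpos: "0 < d i" for i using \<open>0 < e\<close> by (simp add: d_def)
  have "\<exists>V. open V \<and> E \<subseteq> V \<and> emeasure N (U i \<inter> (V - E)) \<le> ennreal (d i)" for i
  proof -
    \<comment> \<open>Restriction to \<open>U i\<close> is written as a density, so that the
      measurable sets stay those of \<open>N\<close>.\<close>
    let ?N = "density N (indicator (U i))"
    have em: "emeasure ?N G = emeasure N (U i \<inter> G)" if "G \<in> sets N" for G
      using that U op by (intro emeasure_restricted) auto
    obtain C V where CV: "closed C" "open V" "C \<subseteq> E" "E \<subseteq> V" "emeasure ?N (V - C) \<le> ennreal (d i)"
      using borel_closed_open_approx[OF _ _ E dpos, of ?N i] borel U(2)[of i] em[of UNIV] op[of UNIV]
      by auto
    have "C \<in> sets N" using CV(1) borel by auto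
    then have "emeasure N (U i \<inter> (V - E)) \<le> emeasure N (U i \<inter> (V - C))"
      using CV op[OF CV(2)] op[OF U(1)] by (intro emeasure_mono) auto
    also have "\<dots> \<le> ennreal (d i)"
      using CV(5) em[of "V - C"] op[OF CV(2)] \<open>C \<in> sets N\<close> by simp
    finally show ?thesis using CV by blast
  qed
  then obtain V where V: "\<And>i. open (V i)" "\<And>i. E \<subseteq> V i"
      "\<And>i. emeasure N (U i \<inter> (V i - E)) \<le> ennreal (d i)"
    by metis
  let ?V = "\<Union>i. U i \<inter> V i"
  have "open ?V" using U(1) V(1) by (intro open_UN ballI open_Int)
  moreover have "E \<subseteq> ?V" using UU V(2) by blast
  moreover have "emeasure N ?V \<le> emeasure N E + ennreal e"
  proof -
    have "emeasure N ?V \<le> emeasure N (E \<union> (\<Union>i. U i \<inter> (V i - E)))"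
      using op[OF U(1)] op[OF V(1)] EN by (intro emeasure_mono) auto
    also have "\<dots> \<le> emeasure N E + emeasure N (\<Union>i. U i \<inter> (V i - E))"
      using op[OF U(1)] op[OF V(1)] EN by (intro emeasure_subadditive) auto
    also have "emeasure N (\<Union>i. U i \<inter> (V i - E)) \<le> (\<Sum>i. emeasure N (U i \<inter> (V i - E)))"
      using op[OF U(1)] op[OF V(1)] EN by (intro emeasure_subadditive_countably) auto
    also have "\<dots> \<le> (\<Sum>i. ennreal (d i))"
      by (intro suminf_le V) auto
    also have "\<dots> = ennreal e"
    proof (intro suminf_ennreal_eq)
      have "d sums (e * 1)"
        unfolding d_def by (intro sums_mult power_half_series)
      then show "d sums e" by simp
    qed (use dpos in \<open>simp add: less_imp_le\<close>)
    finally show ?thesis by (simp add: add_left_mono)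
  qed
  ultimately show ?thesis by blast
qed

text \<open>Continuity from below holds even for nonmeasurable sets, by passing to Borel hulls of
  equal measure.\<close>

lemma borel_regular_UN_incseq:
  fixes \<mu> :: "'a::metric_space set \<Rightarrow> ennreal"
  assumes reg: "borel_regular \<mu>" and "incseq E"
  shows "\<mu> (\<Union>n. E n) \<le> (SUP n. \<mu> (E n))"
proof -
  have \<mu>: "outer_measure_space UNIV \<mu>" using reg by (simp add: borel_regular_def)
  have bor: "sets borel \<subseteq> lambda_system UNIV UNIV \<mu>"
    using reg by (intro borel_subset_lambda_system) (auto simp: borel_regular_def)
  let ?N = "outer_to_measure \<mu>"
  have N: "G \<in> sets ?N" "emeasure ?N G = \<mu> G" if "G \<in> sets borel" for G
    using that bor emeasure_outer_to_measure[OF \<mu>] by (auto simp: sets_outer_to_measure[OF \<mu>])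
  have "\<forall>n. \<exists>H\<in>sets borel. E n \<subseteq> H \<and> \<mu> H = \<mu> (E n)"
    using reg by (simp add: borel_regular_def)
  then obtain H where H: "\<And>n. H n \<in> sets borel" "\<And>n. E n \<subseteq> H n" "\<And>n. \<mu> (H n) = \<mu> (E n)"
    by metis
  \<comment> \<open>The hulls \<open>H n\<close> need not increase, but these tail intersections do.
    They still contain \<open>E n\<close>, since \<open>E n \<subseteq> E j \<subseteq> H j\<close>
    for \<open>j \<ge> n\<close>.\<close>
  define G where "G n = (\<Inter>j\<in>{n..}. H j)" for n
  have Gb: "G n \<in> sets borel" for n
    unfolding G_def using H(1) by (intro sets.countable_INT) auto
  have EG: "E n \<subseteq> G n" for n
    using H(2) \<open>incseq E\<close> unfolding G_def incseq_def by blast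
  have "\<mu> (\<Union>n. E n) \<le> \<mu> (\<Union>n. G n)"
    using EG by (intro outer_measure_mono[OF \<mu>]) blast
  also have "\<dots> = (SUP n. \<mu> (G n))"
  proof -
    have "(\<Union>n. G n) \<in> sets borel" using Gb by auto
    moreover have "incseq G" unfolding incseq_def G_def by auto
    ultimately show ?thesis
      using SUP_emeasure_incseq[of G ?N] N Gb by (simp add: image_subset_iff)
  qed
  also have "\<dots> \<le> (SUP n. \<mu> (E n))"
  proof (intro SUP_mono' )
    fix n
    have "G n \<subseteq> H n" unfolding G_def by auto
    then show "\<mu> (G n) \<le> \<mu> (E n)"
      using outer_measure_mono[OF \<mu>] H(3) by metis
  qed
  finally show ?thesis .
qed

subsection \<open>Comparison of \<open>\<mu>\<close> and \<open>\<psi>\<close> under density bounds\<close>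

lemma ennreal_le_times_iff:
  fixes a b :: ennreal
  assumes "0 < t"
  shows "a \<le> ennreal t * b \<longleftrightarrow> ennreal (1 / t) * a \<le> b"
proof -
  have "ennreal (1 / t) * ennreal t = 1"
    using assms by (simp add: ennreal_mult[symmetric])
  then have "ennreal (1 / t) * (ennreal t * b) = b" "ennreal t * (ennreal (1 / t) * a) = a"
    by (metis mult.assoc mult.commute mult_1)+
  then show ?thesis
    by (metis mult_left_mono zero_le)
qed

text \<open>Since \<open>\<zeta> S\<close> is finite, a member of \<open>\<S>\<close> left out of
  the reduced family has \<open>\<mu> S = 0\<close>. Inside it, the finite bound rules out
  \<open>\<zeta> S = 0\<close>, where the quotient is infinite.\<close>

lemma measure_le_of_density_quotient_le:
  assumes "S \<in> \<S>" "\<zeta> S < \<infinity>" "S \<in> reduced_family \<S> \<mu> \<zeta> \<Longrightarrow> density_quotient \<mu> \<zeta> S \<le> ennreal t"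
  shows "\<mu> S \<le> ennreal t * \<zeta> S"
proof (cases "S \<in> reduced_family \<S> \<mu> \<zeta>")
  case True
  then have "density_quotient \<mu> \<zeta> S \<le> ennreal t" by (rule assms(3))
  then have z: "\<zeta> S \<noteq> 0" and q: "\<mu> S / \<zeta> S \<le> ennreal t"
    using assms(2) by (auto simp: density_quotient_def top_unique split: if_splits)
  have "\<mu> S = \<mu> S / \<zeta> S * \<zeta> S"
    using z assms(2) by (simp add: ennreal_divide_times ennreal_divide_self)
  also have "\<dots> \<le> ennreal t * \<zeta> S" by (intro mult_right_mono q) simp
  finally show ?thesis .
next
  case False
  then show ?thesis using assms(1,2) by (auto simp: reduced_family_def)
qed

lemma measure_ge_of_density_quotient_gt:
  assumes "\<zeta> S < \<infinity>" "ennreal t < density_quotient \<mu> \<zeta> S"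
  shows "ennreal t * \<zeta> S \<le> \<mu> S"
proof (cases "\<zeta> S = 0")
  case False
  then have "ennreal t \<le> \<mu> S / \<zeta> S"
    using assms by (simp add: density_quotient_def split: if_splits)
  then have "ennreal t * \<zeta> S \<le> \<mu> S / \<zeta> S * \<zeta> S" by (intro mult_right_mono) auto
  also have "\<dots> = \<mu> S"
    using False assms(1) by (simp add: ennreal_divide_times ennreal_divide_self)
  finally show ?thesis .
qed simp

text \<open>On \<open>D n\<close> the density bound holds at one common scale, which allows a
  comparison term by term along covers. The sets \<open>D n\<close> need not be Borel, so the
  passage to \<open>E\<close> relies on hulls.\<close>

lemma measure_le_carath_measure:
  fixes \<mu> :: "'a::metric_space set \<Rightarrow> ennreal"
  assumes reg: "borel_regular \<mu>" and fin: "\<And>S. S \<in> \<S> \<Longrightarrow> \<zeta> S < \<infinity>"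
    and "0 < t" and F: "\<And>x. x \<in> E \<Longrightarrow> federer_density \<S> \<mu> \<zeta> x < ennreal t"
  shows "\<mu> E \<le> ennreal t * carath_measure \<S> \<zeta> E"
proof -
  have \<mu>: "outer_measure_space UNIV \<mu>" using reg by (simp add: borel_regular_def)
  define D where "D n = {x\<in>E. \<forall>S\<in>reduced_family \<S> \<mu> \<zeta>. x \<in> S \<and> ediam S < ennreal (1 / real (Suc n)) \<longrightarrow>
    density_quotient \<mu> \<zeta> S \<le> ennreal t}" for n
  have "incseq D"
  proof (rule incseq_SucI, rule subsetI)
    fix n x assume x: "x \<in> D n"
    have "ennreal (1 / real (Suc (Suc n))) \<le> ennreal (1 / real (Suc n))"
      by (intro ennreal_leI) (simp add: frac_le)
    then show "x \<in> D (Suc n)"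
      using x less_le_trans unfolding D_def by blast
  qed
  have "E \<subseteq> (\<Union>n. D n)"
  proof
    fix x assume x: "x \<in> E"
    obtain \<epsilon> where "0 < \<epsilon>"
      and e: "(SUP S\<in>{S\<in>reduced_family \<S> \<mu> \<zeta>. x \<in> S \<and> ediam S < ennreal \<epsilon>}. density_quotient \<mu> \<zeta> S) < ennreal t"
      using F[OF x] unfolding federer_density_def INF_less_iff by auto
    obtain n where n: "1 / real (Suc n) < \<epsilon>" using nat_approx_posE[OF \<open>0 < \<epsilon>\<close>] .
    have "density_quotient \<mu> \<zeta> S \<le> ennreal t"
      if "S \<in> reduced_family \<S> \<mu> \<zeta>" "x \<in> S" "ediam S < ennreal (1 / real (Suc n))" for S
    proof -
      have "ennreal (1 / real (Suc n)) \<le> ennreal \<epsilon>"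
        using n by (intro ennreal_leI less_imp_le)
      with that have "ediam S < ennreal \<epsilon>" using less_le_trans by blast
      then have "density_quotient \<mu> \<zeta> S \<le>
          (SUP S\<in>{S\<in>reduced_family \<S> \<mu> \<zeta>. x \<in> S \<and> ediam S < ennreal \<epsilon>}. density_quotient \<mu> \<zeta> S)"
        using that by (intro SUP_upper) auto
      then show ?thesis using e by (meson less_imp_le order_trans)
    qed
    then show "x \<in> (\<Union>n. D n)" using x unfolding D_def by blast
  qed
  then have "\<mu> E \<le> \<mu> (\<Union>n. D n)" by (rule outer_measure_mono[OF \<mu>])
  also have "\<dots> \<le> (SUP n. \<mu> (D n))"
    by (rule borel_regular_UN_incseq[OF reg \<open>incseq D\<close>])
  also have "\<dots> \<le> ennreal t * carath_measure \<S> \<zeta> E"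
  proof (rule SUP_least)
    fix n
    \<comment> \<open>Covers allow diameter equal to \<open>\<delta>\<close> whereas
      \<open>D n\<close> controls strictly smaller diameters than \<open>1 / Suc n\<close>, hence
      the next reciprocal.\<close>
    define \<delta> where "\<delta> = 1 / real (Suc (Suc n))"
    have "\<delta> > 0" by (simp add: \<delta>_def)
    have \<delta>: "ennreal \<delta> < ennreal (1 / real (Suc n))"
      unfolding \<delta>_def by (intro ennreal_lessI) (simp_all add: frac_less2)
    have "ennreal (1 / t) * \<mu> (D n) \<le> size_delta \<S> \<zeta> \<delta> (D n)"
      unfolding size_delta_def
    proof (rule INF_greatest, clarify)
      fix \<G> assume G: "\<G> \<subseteq> \<S>" "countable \<G>" "\<forall>S\<in>\<G>. ediam S \<le> ennreal \<delta>" "D n \<subseteq> \<Union>\<G>"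
      \<comment> \<open>Only members that meet \<open>D n\<close> have a controlled quotient;
        dropping the others still leaves a cover.\<close>
      let ?H = "{S\<in>\<G>. S \<inter> D n \<noteq> {}}"
      have "D n \<subseteq> \<Union>?H"
      proof
        fix x assume "x \<in> D n"
        moreover from this obtain S where "S \<in> \<G>" "x \<in> S" using G(4) by blast
        ultimately show "x \<in> \<Union>?H" by blast
      qed
      then have "\<mu> (D n) \<le> infsum \<mu> ?H"
        using G(2) by (intro outer_measure_le_infsum[OF \<mu>]) auto
      also have "\<dots> \<le> infsum (\<lambda>S. ennreal t * \<zeta> S) \<G>"
      proof (rule infsum_mono_ennreal)
        fix S assume S: "S \<in> ?H"
        then obtain x where x: "x \<in> S" "x \<in> D n" by blast
        have "ediam S < ennreal (1 / real (Suc n))"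
          using S G(3) \<delta> le_less_trans by blast
        then have "density_quotient \<mu> \<zeta> S \<le> ennreal t" if "S \<in> reduced_family \<S> \<mu> \<zeta>"
          using x that by (auto simp: D_def)
        then show "\<mu> S \<le> ennreal t * \<zeta> S"
          using S G(1) fin by (intro measure_le_of_density_quotient_le[of S \<S>]) auto
      qed auto
      finally show "ennreal (1 / t) * \<mu> (D n) \<le> infsum \<zeta> \<G>"
        by (simp add: infsum_cmult_ennreal ennreal_le_times_iff[OF \<open>0 < t\<close>])
    qed
    also have "\<dots> \<le> carath_measure \<S> \<zeta> (D n)"
      by (rule size_delta_le_carath[OF \<open>0 < \<delta>\<close>])
    also have "\<dots> \<le> carath_measure \<S> \<zeta> E"
      by (rule outer_measure_mono[OF outer_measure_space_carath_measure]) (auto simp: D_def)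
    finally show "\<mu> (D n) \<le> ennreal t * carath_measure \<S> \<zeta> E"
      by (simp add: ennreal_le_times_iff[OF \<open>0 < t\<close>])
  qed
  finally show ?thesis .
qed

text \<open>Zorn's lemma is applied to disjoint subfamilies that dominate, up to the factor 2, every
  set they meet. If a maximal one missed some set of \<open>\<G>\<close>, a missed set of nearly
  largest diameter could be added to it.\<close>

lemma vitali_disjoint_subfamily:
  fixes \<G> :: "'a::metric_space set set"
  assumes bound: "\<And>S. S \<in> \<G> \<Longrightarrow> ediam S \<le> ennreal M" and nonempty: "{} \<notin> \<G>"
  obtains \<H> where "\<H> \<subseteq> \<G>" "pairwise disjnt \<H>"
    "\<And>T. T \<in> \<G> \<Longrightarrow> \<exists>S\<in>\<H>. T \<inter> S \<noteq> {} \<and> ediam T \<le> 2 * ediam S"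
proof -
  define meets where "meets T \<H> \<longleftrightarrow> (\<exists>S\<in>\<H>. T \<inter> S \<noteq> {})" for T :: "'a set" and \<H>
  define good where "good T \<H> \<longleftrightarrow> (\<exists>S\<in>\<H>. T \<inter> S \<noteq> {} \<and> ediam T \<le> 2 * ediam S)" for T :: "'a set" and \<H>
  define \<Omega> where "\<Omega> = {\<H>. \<H> \<subseteq> \<G> \<and> pairwise disjnt \<H> \<and> (\<forall>T\<in>\<G>. meets T \<H> \<longrightarrow> good T \<H>)}"
  have "\<exists>\<H>\<in>\<Omega>. \<forall>X\<in>\<Omega>. \<H> \<subseteq> X \<longrightarrow> X = \<H>"
  proof (rule subset_Zorn_nonempty)
    show "\<Omega> \<noteq> {}" by (auto simp: \<Omega>_def meets_def intro!: exI[of _ "{}"])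
    fix \<C> assume C: "\<C> \<noteq> {}" "subset.chain \<Omega> \<C>"
    then have sub: "\<C> \<subseteq> \<Omega>" by (simp add: subset.chain_def)
    have "pairwise disjnt (\<Union>\<C>)"
    proof (rule pairwise_chain_Union)
      show "chain\<^sub>\<subseteq> \<C>" using C(2) by (auto simp: chain_subset_def subset.chain_def)
    qed (use sub in \<open>auto simp: \<Omega>_def\<close>)
    moreover have "good T (\<Union>\<C>)" if "T \<in> \<G>" "meets T (\<Union>\<C>)" for T
    proof -
      obtain \<H> where H: "\<H> \<in> \<C>" "meets T \<H>" using \<open>meets T (\<Union>\<C>)\<close> by (auto simp: meets_def)
      then have "good T \<H>" using sub \<open>T \<in> \<G>\<close> by (auto simp: \<Omega>_def)
      with H(1) show ?thesis unfolding good_def by blast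
    qed
    ultimately show "\<Union>\<C> \<in> \<Omega>"
      using sub by (auto simp: \<Omega>_def)
  qed
  then obtain \<H> where H: "\<H> \<in> \<Omega>" and max: "\<And>X. X \<in> \<Omega> \<Longrightarrow> \<H> \<subseteq> X \<Longrightarrow> X = \<H>" by blast
  have "meets T \<H>" if "T \<in> \<G>" for T
  proof (rule ccontr)
    define \<K> where "\<K> = {T\<in>\<G>. \<not> meets T \<H>}"
    define s where "s = (SUP T\<in>\<K>. ediam T)"
    assume "\<not> meets T \<H>"
    with that have T: "T \<in> \<K>" by (simp add: \<K>_def)
    have "s \<le> ennreal M" unfolding s_def by (rule SUP_least) (auto simp: \<K>_def bound)
    then have sfin: "s < top" by (rule le_less_trans) simp
    \<comment> \<open>For \<open>s = 0\<close> every missed set will do. Otherwise \<open>s\<close>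
      is finite and positive, so \<open>s < 2 * s\<close> leaves room to choose \<open>W\<close>
      near the supremum.\<close>
    have "\<exists>W\<in>\<K>. s \<le> 2 * ediam W"
    proof (cases "s = 0")
      case False
      then have "s + 0 < s + s"
        using sfin by (subst ennreal_add_left_cancel_less) (simp add: zero_less_iff_neq_zero)
      also have "s + s = (SUP T\<in>\<K>. 2 * ediam T)"
        by (simp add: s_def SUP_mult_left_ennreal mult_2[symmetric])
      finally obtain W where "W \<in> \<K>" "s < 2 * ediam W"
        unfolding less_SUP_iff by auto
      then show ?thesis by (auto intro: less_imp_le)
    qed (use T in auto)
    then obtain W where W: "W \<in> \<K>" "s \<le> 2 * ediam W" by blast
    have "insert W \<H> \<in> \<Omega>"
    proof -
      have "pairwise disjnt (insert W \<H>)"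
        using H W(1) by (auto simp: pairwise_insert \<Omega>_def \<K>_def meets_def disjnt_def)
      moreover have "good U (insert W \<H>)" if U: "U \<in> \<G>" "meets U (insert W \<H>)" for U
      proof (cases "meets U \<H>")
        case True
        then show ?thesis using H U(1) by (auto simp: \<Omega>_def good_def)
      next
        case False
        then have "U \<inter> W \<noteq> {}" using U(2) by (auto simp: meets_def)
        moreover have "ediam U \<le> s"
          unfolding s_def using False U(1) by (intro SUP_upper) (auto simp: \<K>_def)
        ultimately show ?thesis using W(2) by (auto simp: good_def intro: order_trans)
      qed
      ultimately show ?thesis using H W(1) by (auto simp: \<Omega>_def \<K>_def)
    qed
    then have "W \<in> \<H>" using max by blast
    \<comment> \<open>A nonempty \<open>W\<close> in \<open>\<H>\<close> meets \<open>\<H>\<close>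
      in itself, contrary to \<open>W \<in> \<K>\<close>.\<close>
    moreover have "W \<noteq> {}" using W(1) nonempty by (auto simp: \<K>_def)
    ultimately show False using W(1) by (auto simp: \<K>_def meets_def)
  qed
  then show ?thesis
    using H that[of \<H>] by (auto simp: \<Omega>_def good_def)
qed

text \<open>Only finitely many terms can reach \<open>1 / Suc n\<close>, and every nonzero term does
  so for some \<open>n\<close>.\<close>

lemma countable_of_infsum_finite:
  fixes f :: "'b \<Rightarrow> ennreal"
  assumes "infsum f H < \<infinity>" and nz: "\<And>x. x \<in> H \<Longrightarrow> f x \<noteq> 0"
  shows "countable H"
proof -
  let ?H = "\<lambda>n. {x\<in>H. ennreal (1 / real (Suc n)) \<le> f x}"
  have "finite (?H n)" for n
  proof (rule ccontr)
    assume "infinite (?H n)"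
    then have "infsum f (?H n) = \<infinity>"
      by (intro infsum_superconst_infinite_ennreal[of _ "ennreal (1 / real (Suc n))"]) auto
    moreover have "infsum f (?H n) \<le> infsum f H" by (rule infsum_mono_ennreal) auto
    ultimately show False using assms(1) by (auto simp: top_unique)
  qed
  then have "countable (\<Union>n. ?H n)" by (intro countable_UN) (auto intro: countable_finite)
  moreover have "H \<subseteq> (\<Union>n. ?H n)"
  proof
    fix x assume x: "x \<in> H"
    have "\<exists>n. ennreal (1 / real (Suc n)) \<le> f x"
    proof (cases "f x")
      case (real r)
      then have "0 < r" using nz[OF x] by (cases "r = 0") auto
      then obtain n where "1 / real (Suc n) < r" by (rule nat_approx_posE)
      then show ?thesis using real by (intro exI[of _ n]) (simp add: ennreal_leI less_imp_le del: of_nat_Suc)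
    qed auto
    with x show "x \<in> (\<Union>n. ?H n)" by blast
  qed
  ultimately show ?thesis by (rule countable_subset[rotated])
qed

text \<open>A disjoint Vitali family inside \<open>V\<close> has total measure at most
  \<open>\<mu> V\<close>. Enlarging only a tail of small total measure confines the loss factor
  \<open>\<eta>\<close> to an arbitrarily small term.\<close>

lemma carath_measure_le_measure_open:
  fixes \<mu> :: "'a::metric_space set \<Rightarrow> ennreal"
  assumes reg: "borel_regular \<mu>" and closed: "\<And>S. S \<in> \<S> \<Longrightarrow> closed S"
    and fin: "\<And>S. S \<in> \<S> \<Longrightarrow> \<zeta> S < \<infinity>"
    and "c > 0" and "\<eta> > 0"
    and enl: "\<And>S. S \<in> \<S> \<Longrightarrow>
           \<exists>S'\<in>\<S>. enlargement \<S> S \<subseteq> S' \<and> ediam S' \<le> ennreal c * ediam S \<and>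
             \<zeta> S' \<le> ennreal \<eta> * \<zeta> S"
    and F: "\<And>x. x \<in> E \<Longrightarrow> ennreal t < federer_density \<S> \<mu> \<zeta> x"
    and V: "open V" "E \<subseteq> V" "\<mu> V < \<infinity>"
  shows "ennreal t * carath_measure \<S> \<zeta> E \<le> \<mu> V"
proof -
  have \<mu>: "outer_measure_space UNIV \<mu>" using reg by (simp add: borel_regular_def)
  have bor: "sets borel \<subseteq> lambda_system UNIV UNIV \<mu>"
    using reg by (intro borel_subset_lambda_system) (auto simp: borel_regular_def)
  let ?N = "outer_to_measure \<mu>"
  have N: "G \<in> sets ?N" "emeasure ?N G = \<mu> G" if "G \<in> sets borel" for G
    using that bor emeasure_outer_to_measure[OF \<mu>] by (auto simp: sets_outer_to_measure[OF \<mu>])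
  obtain tl where tl: "\<And>S. S \<in> \<S> \<Longrightarrow> tl S \<in> \<S>" "\<And>S. S \<in> \<S> \<Longrightarrow> enlargement \<S> S \<subseteq> tl S"
     "\<And>S. S \<in> \<S> \<Longrightarrow> ediam (tl S) \<le> ennreal c * ediam S" "\<And>S. S \<in> \<S> \<Longrightarrow> \<zeta> (tl S) \<le> ennreal \<eta> * \<zeta> S"
    using enl by metis
  have small: "\<exists>S\<in>reduced_family \<S> \<mu> \<zeta>. x \<in> S \<and> S \<subseteq> W \<and> ediam S < ennreal r \<and> ennreal t < density_quotient \<mu> \<zeta> S"
    if x: "x \<in> E" "x \<in> W" and W: "open W" and "0 < r" for x W r
  proof -
    obtain \<rho> where \<rho>: "\<rho> > 0" "ball x \<rho> \<subseteq> W" using W x(2) open_contains_ball by blast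
    let ?m = "min r \<rho>"
    have "federer_density \<S> \<mu> \<zeta> x \<le> (SUP S\<in>{S\<in>reduced_family \<S> \<mu> \<zeta>. x \<in> S \<and> ediam S < ennreal ?m}. density_quotient \<mu> \<zeta> S)"
      unfolding federer_density_def using \<rho>(1) \<open>0 < r\<close> by (intro INF_lower) auto
    with F[OF x(1)] have "ennreal t < \<dots>" by (rule less_le_trans)
    then obtain S where S: "S \<in> reduced_family \<S> \<mu> \<zeta>" "x \<in> S" "ediam S < ennreal ?m" "ennreal t < density_quotient \<mu> \<zeta> S"
      unfolding less_SUP_iff by blast
    have "y \<in> ball x \<rho>" if "y \<in> S" for y
    proof -
      have "ennreal (dist x y) < ennreal ?m"
        using dist_le_ediam[OF S(2) that] S(3) by (rule le_less_trans)
      then show ?thesis by (simp add: ennreal_less_iff)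
    qed
    moreover have "ediam S < ennreal r"
      using S(3) by (rule less_le_trans) (simp add: ennreal_leI)
    ultimately show ?thesis using S \<rho>(2) by blast
  qed
  have main: "ennreal t * size_delta \<S> \<zeta> \<delta> E \<le> \<mu> V + ennreal \<eta> * ennreal e" if "0 < \<delta>" "0 < e" for \<delta> e
  proof -
    \<comment> \<open>At this scale both a set and its enlargement, whose diameter grows by at most
      the factor \<open>c\<close>, are admissible for \<open>\<delta>\<close>.\<close>
    define r where "r = min \<delta> (\<delta> / c)"
    have r: "0 < r" "r \<le> \<delta>" "c * r \<le> \<delta>"
      using \<open>0 < \<delta>\<close> \<open>c > 0\<close> by (auto simp: r_def min_def field_simps)
    define \<G> where "\<G> = {S\<in>reduced_family \<S> \<mu> \<zeta>. S \<noteq> {} \<and> S \<subseteq> V \<and> ediam S < ennreal r \<and>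
      ennreal t < density_quotient \<mu> \<zeta> S}"
    have GS: "S \<in> \<S>" "closed S" "\<zeta> S < \<infinity>" if "S \<in> \<G>" for S
      using that closed fin by (auto simp: \<G>_def reduced_family_def)
    have Gb: "S \<in> sets borel" if "S \<in> \<G>" for S
      using GS(2)[OF that] by simp
    have Gt: "ennreal t * \<zeta> S \<le> \<mu> S" if "S \<in> \<G>" for S
      using that GS(3)[OF that] by (intro measure_ge_of_density_quotient_gt) (auto simp: \<G>_def)
    \<comment> \<open>If \<open>\<zeta> S = 0\<close>, membership in the reduced family excludes
      \<open>\<mu> S = 0\<close>; otherwise the quotient is positive. This makes \<open>\<H>\<close>
      countable below.\<close>
    have Gpos: "\<mu> S \<noteq> 0" if "S \<in> \<G>" for S
      using that GS(3)[OF that] by (auto simp: \<G>_def reduced_family_def density_quotient_def split: if_splits)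
    have Gd: "ediam S \<le> ennreal r" if "S \<in> \<G>" for S
      using that by (simp add: \<G>_def less_imp_le)
    obtain \<H> where H: "\<H> \<subseteq> \<G>" "pairwise disjnt \<H>"
      "\<And>T. T \<in> \<G> \<Longrightarrow> \<exists>S\<in>\<H>. T \<inter> S \<noteq> {} \<and> ediam T \<le> 2 * ediam S"
      using vitali_disjoint_subfamily[of \<G> r] Gd by (auto simp: \<G>_def)
    have sumV: "sum \<mu> K \<le> \<mu> V" if K: "finite K" "K \<subseteq> \<H>" for K
    proof -
      have Kb: "S \<in> sets borel" if "S \<in> K" for S using that K H(1) Gb by blast
      have "sum \<mu> K = sum (\<lambda>S. emeasure ?N S) K"
        using N(2)[OF Kb] by simp
      also have "\<dots> = emeasure ?N (\<Union>S\<in>K. S)"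
      proof (rule sum_emeasure)
        show "disjoint_family_on (\<lambda>S. S) K"
          using H(2) K(2) by (auto simp: disjoint_family_on_def pairwise_def disjnt_def)
      qed (use Kb N(1) K in auto)
      also have "\<dots> = \<mu> (\<Union>K)"
        using Kb K(1) N(2)[of "\<Union>K"] by (simp add: sets.finite_Union subset_iff)
      also have "\<dots> \<le> \<mu> V"
        using K(2) H(1) by (intro outer_measure_mono[OF \<mu>]) (auto simp: \<G>_def)
      finally show ?thesis .
    qed
    have HV: "infsum \<mu> \<H> \<le> \<mu> V"
      by (subst nonneg_infsum_complete) (auto intro!: SUP_least sumV)
    then have Hfin: "infsum \<mu> \<H> < \<infinity>" using V(3) by (rule le_less_trans)
    have Hc: "countable \<H>"
      using H(1) Gpos by (intro countable_of_infsum_finite[OF Hfin]) auto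
    have "\<exists>K\<in>{K. finite K \<and> K \<subseteq> \<H>}. infsum \<mu> \<H> < sum \<mu> K + ennreal e"
    proof (rule SUP_approx_ennreal[OF \<open>0 < e\<close>])
      show "infsum \<mu> \<H> = (SUP K\<in>{K. finite K \<and> K \<subseteq> \<H>}. sum \<mu> K)"
        by (rule nonneg_infsum_complete) simp
    qed (use Hfin in auto)
    then obtain K where K: "finite K" "K \<subseteq> \<H>" "infsum \<mu> \<H> < sum \<mu> K + ennreal e" by blast
    have "infsum \<mu> (K \<union> (\<H> - K)) = infsum \<mu> K + infsum \<mu> (\<H> - K)"
      by (rule infsum_Un_disjoint) (auto intro: nonneg_summable_on_complete)
    moreover have "K \<union> (\<H> - K) = \<H>" using K(2) by auto
    ultimately have "sum \<mu> K + infsum \<mu> (\<H> - K) \<le> sum \<mu> K + ennreal e"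
      using K by (simp add: less_imp_le)
    then have tail: "infsum \<mu> (\<H> - K) \<le> ennreal e"
      using sumV[OF K(1,2)] V(3) by (auto simp: ennreal_add_left_cancel_le)
    \<comment> \<open>A point outside the closed set \<open>\<Union>K\<close> lies in some small
      \<open>T\<close> of \<open>\<G>\<close> avoiding it. The member of \<open>\<H>\<close> that
      dominates \<open>T\<close> is then not in \<open>K\<close>, so its enlargement contains the
      point.\<close>
    let ?C = "K \<union> tl ` (\<H> - K)"
    have cov: "E \<subseteq> \<Union>?C"
    proof
      fix x assume x: "x \<in> E"
      show "x \<in> \<Union>?C"
      proof (cases "x \<in> \<Union>K")
        case False
        have "closed (\<Union>K)" using K H(1) GS(2) by (intro closed_Union) auto
        then have "open (V - \<Union>K)" using V(1) by (rule open_Diff[rotated])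
        then obtain T where T: "T \<in> reduced_family \<S> \<mu> \<zeta>" "x \<in> T" "T \<subseteq> V - \<Union>K" "ediam T < ennreal r"
            "ennreal t < density_quotient \<mu> \<zeta> T"
          using small[OF x, of "V - \<Union>K" r] False x V(2) r(1) by blast
        then have "T \<in> \<G>" by (auto simp: \<G>_def)
        then obtain S where S: "S \<in> \<H>" "T \<inter> S \<noteq> {}" "ediam T \<le> 2 * ediam S" using H(3) by blast
        then have "S \<notin> K" using T(3) by blast
        have "T \<subseteq> enlargement \<S> S"
          using S GS(1)[OF \<open>T \<in> \<G>\<close>] by (auto simp: enlargement_def)
        also have "\<dots> \<subseteq> tl S" using S(1) H(1) GS(1) by (intro tl) auto
        finally show ?thesis using T(2) S(1) \<open>S \<notin> K\<close> by blast
      qed blast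
    qed
    have HS: "S \<in> \<S>" if "S \<in> \<H>" for S using that H(1) GS(1) by blast
    have "?C \<subseteq> \<S>" using HS K(2) tl(1) by auto
    moreover have "ediam S \<le> ennreal \<delta>" if "S \<in> ?C" for S
      using that
    proof
      assume "S \<in> K"
      then have "ediam S \<le> ennreal r" using K(2) H(1) Gd by blast
      then show ?thesis using r(2) ennreal_leI order_trans by blast
    next
      assume "S \<in> tl ` (\<H> - K)"
      then obtain T where T: "T \<in> \<H>" "S = tl T" by blast
      have "ediam S \<le> ennreal c * ediam T" using T HS tl(3) by simp
      also have "\<dots> \<le> ennreal c * ennreal r"
        using T(1) H(1) Gd by (intro mult_left_mono) auto
      also have "\<dots> \<le> ennreal \<delta>"
        using r \<open>c > 0\<close> by (simp add: ennreal_mult[symmetric] ennreal_leI)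
      finally show ?thesis .
    qed
    moreover have "countable ?C" using Hc K(1) by (auto intro: countable_finite)
    ultimately have "size_delta \<S> \<zeta> \<delta> E \<le> infsum \<zeta> ?C"
      unfolding size_delta_def using cov by (intro INF_lower) auto
    also have "\<dots> \<le> infsum \<zeta> K + infsum \<zeta> (tl ` (\<H> - K))"
      by (rule infsum_Un_le_ennreal)
    also have "\<dots> \<le> infsum \<zeta> K + infsum (\<lambda>S. \<zeta> (tl S)) (\<H> - K)"
      by (intro add_left_mono infsum_image_le_ennreal)
    also have "\<dots> \<le> infsum \<zeta> K + infsum (\<lambda>S. ennreal \<eta> * \<zeta> S) (\<H> - K)"
      using HS by (intro add_left_mono infsum_mono_ennreal) (auto intro: tl)
    finally have "ennreal t * size_delta \<S> \<zeta> \<delta> E \<le>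
        ennreal t * (infsum \<zeta> K + ennreal \<eta> * infsum \<zeta> (\<H> - K))"
      by (intro mult_left_mono) (auto simp: infsum_cmult_ennreal)
    also have "\<dots> = infsum (\<lambda>S. ennreal t * \<zeta> S) K + ennreal \<eta> * infsum (\<lambda>S. ennreal t * \<zeta> S) (\<H> - K)"
      by (simp add: infsum_cmult_ennreal distrib_left mult.left_commute del: infsum_finite)
    also have "\<dots> \<le> infsum \<mu> K + ennreal \<eta> * infsum \<mu> (\<H> - K)"
      using H(1) K(2) by (intro add_mono mult_left_mono infsum_mono_ennreal) (auto intro!: Gt)
    also have "\<dots> \<le> \<mu> V + ennreal \<eta> * ennreal e"
      using K sumV tail by (intro add_mono mult_left_mono) auto
    finally show ?thesis .
  qed
  have "ennreal t * size_delta \<S> \<zeta> \<delta> E \<le> \<mu> V" if "0 < \<delta>" for \<delta>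
  proof (rule ennreal_le_epsilon)
    fix e :: real assume "0 < e"
    \<comment> \<open>The choice \<open>e / \<eta>\<close> cancels the enlargement factor.\<close>
    then have "ennreal t * size_delta \<S> \<zeta> \<delta> E \<le> \<mu> V + ennreal \<eta> * ennreal (e / \<eta>)"
      using \<open>\<eta> > 0\<close> by (intro main that) auto
    also have "ennreal \<eta> * ennreal (e / \<eta>) = ennreal e"
      using \<open>\<eta> > 0\<close> \<open>0 < e\<close> by (simp add: ennreal_mult[symmetric])
    finally show "ennreal t * size_delta \<S> \<zeta> \<delta> E \<le> \<mu> V + ennreal e" .
  qed
  then show ?thesis
    unfolding carath_measure_def by (auto simp: SUP_mult_left_ennreal intro!: SUP_least)
qed

subsection \<open>The integral representation\<close>

text \<open>For finite \<open>b = ennreal r\<close> the factor \<open>1 + e / (r + 1)\<close> raises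
  \<open>b\<close> by at most \<open>e\<close>; the \<open>+ 1\<close> covers
  \<open>r = 0\<close>.\<close>

lemma ennreal_le_of_le_mult:
  fixes a b :: ennreal
  assumes "\<And>l. 1 < l \<Longrightarrow> a \<le> ennreal l * b"
  shows "a \<le> b"
proof (rule ennreal_le_epsilon)
  fix e :: real assume "b < top" "0 < e"
  then obtain r where r: "b = ennreal r" "0 \<le> r" by (cases b) auto
  have "a \<le> ennreal (1 + e / (r + 1)) * b"
    using r \<open>0 < e\<close> by (intro assms) simp
  also have "\<dots> = ennreal ((1 + e / (r + 1)) * r)"
    using r \<open>0 < e\<close> by (simp add: ennreal_mult)
  also have "\<dots> \<le> ennreal (r + e)"
    using r \<open>0 < e\<close> by (intro ennreal_leI) (simp add: field_simps)
  also have "\<dots> = b + ennreal e"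
    using r \<open>0 < e\<close> by simp
  finally show "a \<le> b + ennreal e" .
qed

text \<open>This isolates the measure theory: \<open>N\<close> and \<open>M\<close> stand for
  \<open>\<mu>\<close> and \<open>\<psi>\<close>, and the two comparison bounds are the only link
  between them. The zero and infinity levels of \<open>f\<close> are removed before the rest is
  sliced geometrically.\<close>

lemma emeasure_eq_nn_integral_of_density_bounds:
  fixes N M :: "'a::topological_space measure" and f :: "'a \<Rightarrow> ennreal"
  assumes bN: "sets borel \<subseteq> sets N" and bM: "sets borel \<subseteq> sets M"
    and f: "f \<in> borel_measurable borel" and B: "B \<in> sets borel"
    and upper: "\<And>E t. E \<in> sets borel \<Longrightarrow> E \<subseteq> B \<Longrightarrow> 0 < t \<Longrightarrow> (\<And>x. x \<in> E \<Longrightarrow> f x < ennreal t) \<Longrightarrow>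
      emeasure N E \<le> ennreal t * emeasure M E"
    and lower: "\<And>E t. E \<in> sets borel \<Longrightarrow> E \<subseteq> B \<Longrightarrow> 0 < t \<Longrightarrow> (\<And>x. x \<in> E \<Longrightarrow> ennreal t < f x) \<Longrightarrow>
      ennreal t * emeasure M E \<le> emeasure N E"
    and zero: "emeasure M {x\<in>B. f x = 0} < \<infinity>" and infinite: "emeasure N {x\<in>B. f x = \<infinity>} = 0"
  shows "emeasure N B = (\<integral>\<^sup>+x\<in>B. f x \<partial>M)"
proof -
  note f[measurable] B[measurable]
  have "UNIV \<in> sets M" by (rule subsetD[OF bM]) simp
  then have sp: "space M = UNIV" using sets.sets_into_space[of UNIV M] by auto
  have fM: "f \<in> borel_measurable M"
    by (rule measurableI) (use bM measurable_sets[OF f] in \<open>auto simp: sp\<close>)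
  have EM: "E \<in> sets M" "E \<in> sets N" if "E \<in> sets borel" for E
    using that bM bN by auto
  define R where "R = density M f"
  have sR: "sets R = sets M" by (simp add: R_def)
  have R: "emeasure R E = (\<integral>\<^sup>+x\<in>E. f x \<partial>M)" if "E \<in> sets borel" for E
    unfolding R_def using that by (intro emeasure_density fM EM)
  let ?Z = "{x\<in>B. f x = 0}" and ?I = "{x\<in>B. f x = \<infinity>}" and ?P = "{x\<in>B. 0 < f x \<and> f x < \<infinity>}"
  have ZI: "?Z \<in> sets borel" "?I \<in> sets borel" "?P \<in> sets borel" by measurable
  \<comment> \<open>On the zero level \<open>upper\<close> holds for every positive
    \<open>t\<close>; since \<open>M\<close> is finite there, the bound tends to 0 with
    \<open>t\<close>.\<close>
  have NZ: "emeasure N ?Z = 0"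
  proof -
    obtain p where p: "emeasure M ?Z = ennreal p" "0 \<le> p"
      using zero by (cases "emeasure M ?Z") auto
    have "emeasure N ?Z \<le> 0"
    proof (rule ennreal_le_epsilon)
      fix e :: real assume "0 < e"
      have "emeasure N ?Z \<le> ennreal (e / (p + 1)) * ennreal p"
        unfolding p(1)[symmetric] using \<open>0 < e\<close> p(2) by (intro upper ZI) auto
      also have "\<dots> = ennreal (e / (p + 1) * p)"
        using p(2) \<open>0 < e\<close> by (intro ennreal_mult[symmetric]) auto
      also have "\<dots> \<le> ennreal e"
        using p(2) \<open>0 < e\<close> by (intro ennreal_leI) (simp add: field_simps)
      finally show "emeasure N ?Z \<le> 0 + ennreal e" by simp
    qed
    then show ?thesis by simp
  qed
  \<comment> \<open>A single value, \<open>t = 1\<close>, suffices in \<open>lower\<close>, as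
    \<open>N\<close> vanishes on \<open>?I\<close>.\<close>
  have MI: "emeasure M ?I = 0"
    using lower[of ?I 1] ZI infinite by auto
  have RZ: "emeasure R ?Z = 0"
  proof -
    have "emeasure R ?Z = (\<integral>\<^sup>+x. 0 \<partial>M)"
      unfolding R[OF ZI(1)] by (intro nn_integral_cong) (auto simp: indicator_def)
    then show ?thesis by simp
  qed
  have RI: "emeasure R ?I = 0"
    unfolding R[OF ZI(2)] using MI EM[OF ZI(2)] by (intro nn_integral_null_set) auto
  have split: "emeasure K B = emeasure K ?P"
    if "sets borel \<subseteq> sets K" "emeasure K ?Z = 0" "emeasure K ?I = 0" for K
  proof -
    have "B = (?P \<union> ?Z) \<union> ?I" by (auto simp: less_top zero_less_iff_neq_zero)
    then have "emeasure K B = emeasure K ((?P \<union> ?Z) \<union> ?I)" by simp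
    also have "\<dots> = emeasure K ?P"
    proof -
      have sets: "?P \<in> sets K" "?P \<union> ?Z \<in> sets K" and null: "?Z \<in> null_sets K" "?I \<in> null_sets K"
        using subsetD[OF that(1) ZI(1)] subsetD[OF that(1) ZI(2)] subsetD[OF that(1) ZI(3)] that(2,3)
        by (auto intro: null_setsI)
      show ?thesis
        unfolding emeasure_Un_null_set[OF sets(2) null(2)] by (rule emeasure_Un_null_set[OF sets(1) null(1)])
    qed
    finally show ?thesis .
  qed
  have slices: "emeasure N ?P \<le> ennreal l * emeasure R ?P \<and>
      emeasure R ?P \<le> ennreal (l * l) * emeasure N ?P" if "1 < l" for l :: real
  proof -
    \<comment> \<open>All integer exponents are needed because \<open>f\<close> may be small or
      large; \<open>int_decode\<close> enumerates them by natural numbers for use in series.\<close>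
    define G where "G n = {x\<in>B. ennreal (l powr of_int (int_decode n)) \<le> f x \<and>
      f x < ennreal (l powr (of_int (int_decode n) + 1))}" for n
    have Gb: "G n \<in> sets borel" for n unfolding G_def by measurable
    \<comment> \<open>The slice index is the floor of the logarithm of \<open>f x\<close>, which
      gives disjointness, and conversely exhaustion of \<open>?P\<close>.\<close>
    have floor: "0 < f x \<and> f x < \<infinity> \<and> \<lfloor>log l (enn2real (f x))\<rfloor> = int_decode n" if "x \<in> G n" for x n
    proof -
      obtain r where r: "f x = ennreal r" "0 \<le> r"
        using \<open>x \<in> G n\<close> by (cases "f x") (auto simp: G_def)
      have pos: "0 < l powr of_int (int_decode n)" using \<open>1 < l\<close> by simp
      have le: "l powr of_int (int_decode n) \<le> r" "r < l powr (of_int (int_decode n) + 1)"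
        using \<open>x \<in> G n\<close> r by (auto simp: G_def ennreal_less_iff)
      with pos have "0 < r" by linarith
      then show ?thesis
        using le r \<open>1 < l\<close> by (simp add: floor_log_eq_powr_iff)
    qed
    have disj: "disjoint_family G"
    proof (unfold disjoint_family_on_def, intro ballI impI)
      fix m n :: nat assume "m \<noteq> n"
      show "G m \<inter> G n = {}"
      proof (rule equals0I)
        fix x assume "x \<in> G m \<inter> G n"
        then have "int_decode m = int_decode n" using floor[of x m] floor[of x n] by simp
        with \<open>m \<noteq> n\<close> show False by (simp add: int_decode_eq)
      qed
    qed
    have UG: "(\<Union>n. G n) = ?P"
    proof (intro equalityI subsetI)
      fix x assume "x \<in> (\<Union>n. G n)"
      then show "x \<in> ?P" using floor by (auto simp: G_def)
    next
      fix x assume x: "x \<in> ?P"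
      then obtain r where r: "f x = ennreal r" "0 < r"
        by (cases "f x") auto
      define n where "n = int_encode \<lfloor>log l r\<rfloor>"
      have "\<lfloor>log l r\<rfloor> = int_decode n" by (simp add: n_def)
      then have "l powr of_int (int_decode n) \<le> r \<and> r < l powr (of_int (int_decode n) + 1)"
        using r(2) \<open>1 < l\<close> by (simp add: floor_log_eq_powr_iff)
      then have "x \<in> G n"
        using x r(2) by (simp add: G_def r(1) ennreal_less_iff ennreal_leI)
      then show "x \<in> (\<Union>n. G n)" by blast
    qed
    have slice: "emeasure N (G n) \<le> ennreal l * emeasure R (G n) \<and>
        emeasure R (G n) \<le> ennreal (l * l) * emeasure N (G n)" for n
    proof -
      define a where "a = l powr of_int (int_decode n)"
      have a: "0 < a" "l powr (of_int (int_decode n) + 1) = l * a"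
        using \<open>1 < l\<close> by (simp_all add: a_def powr_add)
      have Gx: "x \<in> B \<and> ennreal a \<le> f x \<and> f x < ennreal (l * a)" if "x \<in> G n" for x
        using that unfolding G_def a_def[symmetric] a(2) by simp
      have la: "0 < l * a" using a(1) \<open>1 < l\<close> by simp
      have "ennreal a * emeasure M (G n) = (\<integral>\<^sup>+x. ennreal a * indicator (G n) x \<partial>M)"
        using EM[OF Gb] by (simp add: nn_integral_cmult_indicator)
      also have "\<dots> \<le> emeasure R (G n)"
        unfolding R[OF Gb] by (intro nn_integral_mono) (auto simp: indicator_def Gx)
      finally have R1: "ennreal a * emeasure M (G n) \<le> emeasure R (G n)" .
      have "emeasure R (G n) \<le> (\<integral>\<^sup>+x. ennreal (l * a) * indicator (G n) x \<partial>M)"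
        unfolding R[OF Gb] using Gx by (intro nn_integral_mono) (auto simp: indicator_def less_imp_le)
      also have "\<dots> = ennreal (l * a) * emeasure M (G n)"
        using EM[OF Gb] by (simp add: nn_integral_cmult_indicator)
      finally have R2: "emeasure R (G n) \<le> ennreal (l * a) * emeasure M (G n)" .
      have "emeasure N (G n) \<le> ennreal (l * a) * emeasure M (G n)"
        using la Gx by (intro upper Gb) auto
      also have "\<dots> = ennreal l * (ennreal a * emeasure M (G n))"
        using a(1) \<open>1 < l\<close> by (simp add: ennreal_mult mult.assoc)
      also have "\<dots> \<le> ennreal l * emeasure R (G n)"
        by (intro mult_left_mono R1) simp
      finally have 1: "emeasure N (G n) \<le> ennreal l * emeasure R (G n)" .
      \<comment> \<open>The bound \<open>lower\<close> wants a strict inequality while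
        \<open>f\<close> may equal \<open>a\<close> on the slice. Stepping down to
        \<open>a / l\<close> costs the second factor \<open>l\<close>.\<close>
      have "ennreal (a / l) < ennreal a"
        using a(1) \<open>1 < l\<close> by (intro ennreal_lessI) (simp_all add: field_simps)
      then have "ennreal (a / l) * emeasure M (G n) \<le> emeasure N (G n)"
        using Gx a(1) \<open>1 < l\<close> by (intro lower Gb) (auto intro: less_le_trans)
      then have "ennreal (l * l) * (ennreal (a / l) * emeasure M (G n)) \<le> ennreal (l * l) * emeasure N (G n)"
        by (rule mult_left_mono) simp
      moreover have "ennreal (l * l) * ennreal (a / l) = ennreal (l * a)"
        using a(1) \<open>1 < l\<close> by (simp add: ennreal_mult[symmetric])
      ultimately have "emeasure R (G n) \<le> ennreal (l * l) * emeasure N (G n)"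
        using R2 by (simp add: mult.assoc[symmetric])
      with 1 show ?thesis by blast
    qed
    have sum: "emeasure K ?P = (\<Sum>n. emeasure K (G n))" if "sets borel \<subseteq> sets K" for K
      unfolding UG[symmetric] using that Gb disj by (intro suminf_emeasure[symmetric]) auto
    have sumN: "emeasure N ?P = (\<Sum>n. emeasure N (G n))" by (rule sum[OF bN])
    have sumR: "emeasure R ?P = (\<Sum>n. emeasure R (G n))" by (rule sum) (use bM sR in simp)
    have "(\<Sum>n. emeasure N (G n)) \<le> (\<Sum>n. ennreal l * emeasure R (G n))"
      by (rule suminf_le[OF slice[THEN conjunct1]]) (rule summableI)+
    moreover have "(\<Sum>n. emeasure R (G n)) \<le> (\<Sum>n. ennreal (l * l) * emeasure N (G n))"
      by (rule suminf_le[OF slice[THEN conjunct2]]) (rule summableI)+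
    ultimately show ?thesis
      unfolding sumN sumR ennreal_suminf_cmult ..
  qed
  have "emeasure N ?P \<le> emeasure R ?P"
    by (rule ennreal_le_of_le_mult[OF slices[THEN conjunct1]])
  moreover have "emeasure R ?P \<le> emeasure N ?P"
  proof (rule ennreal_le_of_le_mult)
    fix l :: real assume "1 < l"
    \<comment> \<open>With \<open>sqrt l\<close> in place of \<open>l\<close>, the squared factor
      becomes \<open>l\<close> itself.\<close>
    then have "emeasure R ?P \<le> ennreal (sqrt l * sqrt l) * emeasure N ?P"
      using slices[of "sqrt l"] by simp
    then show "emeasure R ?P \<le> ennreal l * emeasure N ?P"
      using \<open>1 < l\<close> by simp
  qed
  ultimately have "emeasure N ?P = emeasure R ?P" by (rule antisym)
  moreover have "emeasure N B = emeasure N ?P"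
    by (rule split[OF bN NZ infinite])
  moreover have "emeasure R B = emeasure R ?P"
    by (rule split) (use bM sR RZ RI in simp_all)
  ultimately show ?thesis using R[OF B] by simp
qed

theorem theorem3:
  fixes \<mu> :: "'a::metric_space set \<Rightarrow> ennreal"
    and \<S> :: "'a set set"
    and \<zeta> :: "'a set \<Rightarrow> ennreal"
    and c \<eta> :: real
    and A :: "'a set"
  assumes "borel_regular \<mu>"
    and "\<exists>\<U>. countable \<U> \<and> (\<forall>U\<in>\<U>. open U \<and> \<mu> U < \<infinity>) \<and> \<Union>\<U> = UNIV"
    and "\<And>S. S \<in> \<S> \<Longrightarrow> closed S"
    and "\<And>S. S \<in> \<S> \<Longrightarrow> \<zeta> S < \<infinity>"
    and "c > 0" and "\<eta> > 0"
    and "\<And>S. S \<in> \<S> \<Longrightarrow>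
           \<exists>S'\<in>\<S>. enlargement \<S> S \<subseteq> S' \<and> ediam S' \<le> ennreal c * ediam S \<and>
             \<zeta> S' \<le> ennreal \<eta> * \<zeta> S"
    and "A \<in> sets borel"
    and "covers_finely (reduced_family \<S> \<mu> \<zeta>) A"
    and "federer_density \<S> \<mu> \<zeta> \<in> borel_measurable (restrict_space borel A)"
    and "carath_measure \<S> \<zeta> {x\<in>A. federer_density \<S> \<mu> \<zeta> x = 0} < \<infinity>"
    and "\<mu> {x\<in>A. federer_density \<S> \<mu> \<zeta> x = \<infinity>} = 0"
  shows "\<forall>B\<in>sets borel. B \<subseteq> A \<longrightarrow>
           \<mu> B = (\<integral>\<^sup>+x\<in>B. federer_density \<S> \<mu> \<zeta> x \<partial>outer_to_measure (carath_measure \<S> \<zeta>))"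
proof (intro ballI impI)
  fix B :: "'a set" assume B: "B \<in> sets borel" "B \<subseteq> A"
  let ?F = "federer_density \<S> \<mu> \<zeta>" and ?\<psi> = "carath_measure \<S> \<zeta>"
  let ?N = "outer_to_measure \<mu>" and ?M = "outer_to_measure ?\<psi>"
  have \<mu>: "outer_measure_space UNIV \<mu>" using assms(1) by (simp add: borel_regular_def)
  note \<psi> = outer_measure_space_carath_measure[of \<S> \<zeta>]
  have b\<mu>: "sets borel \<subseteq> lambda_system UNIV UNIV \<mu>"
    using assms(1) by (intro borel_subset_lambda_system) (auto simp: borel_regular_def)
  have bN: "sets borel \<subseteq> sets ?N" using b\<mu> by (simp add: sets_outer_to_measure[OF \<mu>])
  have bM: "sets borel \<subseteq> sets ?M"
    using borel_carath_measurable by (simp add: sets_outer_to_measure[OF \<psi>])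
  have N: "emeasure ?N E = \<mu> E" if "E \<in> sets borel" for E
    using that b\<mu> by (intro emeasure_outer_to_measure[OF \<mu>]) auto
  have M: "emeasure ?M E = ?\<psi> E" if "E \<in> sets borel" for E
    using that borel_carath_measurable by (intro emeasure_outer_to_measure[OF \<psi>]) auto
  from assms(2) obtain \<U> where
    "countable \<U> \<and> (\<forall>U\<in>\<U>. open U \<and> \<mu> U < \<infinity>) \<and> \<Union>\<U> = UNIV" ..
  then have U: "countable \<U>" "\<And>U. U \<in> \<U> \<Longrightarrow> open U \<and> \<mu> U < \<infinity>" "\<Union>\<U> = UNIV"
    by simp_all
  \<comment> \<open>The density is Borel on \<open>A\<close> only; extension by zero makes it Borel
    on the whole space without changing it on \<open>B\<close>.\<close>
  define f where "f x = ?F x * indicator A x" for x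
  have f: "f \<in> borel_measurable borel"
    unfolding f_def using assms(8,10) by (subst borel_measurable_restrict_space_iff_ennreal[symmetric]) auto
  have fB: "f x = ?F x" if "x \<in> B" for x
    using that B(2) by (auto simp: f_def indicator_def)
  have sub: "{x\<in>B. f x = v} \<subseteq> {x\<in>A. ?F x = v}" for v
    using B(2) fB by auto
  have level: "{x\<in>B. f x = v} \<in> sets borel" for v
  proof -
    have "f -` {v} \<inter> space borel \<in> sets borel" by (rule measurable_sets[OF f]) simp
    then have "f -` {v} \<inter> B \<in> sets borel" using B(1) by simp
    moreover have "f -` {v} \<inter> B = {x\<in>B. f x = v}" by auto
    ultimately show ?thesis by simp
  qed
  have "emeasure ?N B = (\<integral>\<^sup>+x\<in>B. f x \<partial>?M)"
  proof (rule emeasure_eq_nn_integral_of_density_bounds[OF bN bM f B(1)])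
    fix E :: "'a set" and t :: real
    assume E: "E \<in> sets borel" "E \<subseteq> B" and "0 < t" and "\<And>x. x \<in> E \<Longrightarrow> f x < ennreal t"
    then have "?F x < ennreal t" if "x \<in> E" for x using that fB by (metis subsetD)
    then have "\<mu> E \<le> ennreal t * ?\<psi> E"
      using assms(4) \<open>0 < t\<close> by (intro measure_le_carath_measure[OF assms(1)])
    then show "emeasure ?N E \<le> ennreal t * emeasure ?M E"
      by (simp add: N M E)
  next
    fix E :: "'a set" and t :: real
    assume E: "E \<in> sets borel" "E \<subseteq> B" and "0 < t" and "\<And>x. x \<in> E \<Longrightarrow> ennreal t < f x"
    then have F: "ennreal t < ?F x" if "x \<in> E" for x using that fB by (metis subsetD)
    have "ennreal t * ?\<psi> E \<le> \<mu> E"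
    \<comment> \<open>The rule leaves only the case of finite \<open>\<mu> E\<close>, where outer
      regularity supplies an open \<open>V\<close> of finite measure.\<close>
    proof (rule ennreal_le_epsilon)
      fix e :: real assume "\<mu> E < top" "0 < e"
      have "\<exists>V. open V \<and> E \<subseteq> V \<and> emeasure ?N V \<le> emeasure ?N E + ennreal e"
        using U N by (intro borel_outer_regular[OF bN U(1) _ U(3) E(1) \<open>0 < e\<close>]) auto
      then obtain V where V: "open V" "E \<subseteq> V" "\<mu> V \<le> \<mu> E + ennreal e"
        using N E(1) by auto
      moreover have "\<mu> V < \<infinity>"
        using V(3) \<open>\<mu> E < top\<close> by (auto intro: le_less_trans)
      ultimately have "ennreal t * ?\<psi> E \<le> \<mu> V"
        using F by (intro carath_measure_le_measure_open[OF assms(1,3-7)]) auto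
      also note V(3)
      finally show "ennreal t * ?\<psi> E \<le> \<mu> E + ennreal e" .
    qed
    then show "ennreal t * emeasure ?M E \<le> emeasure ?N E"
      by (simp add: N M E)
  next
    show "emeasure ?M {x\<in>B. f x = 0} < \<infinity>"
      unfolding M[OF level] using outer_measure_mono[OF \<psi> sub] assms(11) by (rule le_less_trans)
    show "emeasure ?N {x\<in>B. f x = \<infinity>} = 0"
      unfolding N[OF level] using outer_measure_mono[OF \<mu> sub, of \<infinity>] assms(12) by simp
  qed
  also have "(\<integral>\<^sup>+x\<in>B. f x \<partial>?M) = (\<integral>\<^sup>+x\<in>B. ?F x \<partial>?M)"
    by (intro nn_integral_cong) (auto simp: indicator_def fB)
  finally show "\<mu> B = (\<integral>\<^sup>+x\<in>B. ?F x \<partial>?M)" using N[OF B(1)] by simp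
qed

end
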